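(* Let $\mathfrak t=(m_1,m_2,\infty)$ be the type of a triangle group with a single cusp, where $2\le m_1\le m_2<\infty$ are integers with $(m_1,m_2)\neq(2,2)$. Let $E_{2,\mathfrak t}$, $E_{4,\mathfrak t}$, $E^{(1)}_{2k,\mathfrak t}$, $E^{(2)}_{2k,\mathfrak t}$ be the Eisenstein series associated to this triangle group (defined in the context). Then, with $h'=\frac{1}{2\pi i}\frac{dh}{d\tau}$, $$E_{2,\mathfrak t}'=\frac{m_1m_2-m_1-m_2}{2m_1m_2}\left(E_{2,\mathfrak t}^2-E_{4,\mathfrak t}\right),$$ $$E_{4,\mathfrak t}'=2\,\frac{m_1m_2-m_1-m_2}{m_1m_2}E_{2,\mathfrak t}E_{4,\mathfrak t}-\frac{m_1-2}{m_1}E^{(1)}_{6,\mathfrak t}-\frac{m_2-2}{m_2}E^{(2)}_{6,\mathfrak t},$$ and, for $k>2$ (with $k\le m_1$ in the first identity and $k\le m_2$ in the second), $$\big(E^{(1)}_{2k,\mathfrak t}\big)'=\frac{k(m_1m_2-m_1-m_2)}{m_1m_2}E_{2,\mathfrak t}E^{(1)}_{2k,\mathfrak t}-\frac{km_2-k-m_2}{m_2}E_{4,\mathfrak t}E^{(1)}_{2k-2,\mathfrak t}-\frac{m_1-k}{m_1}E^{(1)}_{2k+2,\mathfrak t},$$ $$\big(E^{(2)}_{2k,\mathfrak t}\big)'=\frac{k(m_1m_2-m_1-m_2)}{m_1m_2}E_{2,\mathfrak t}E^{(2)}_{2k,\mathfrak t}-\frac{km_1-k-m_1}{m_1}E_{4,\mathfrak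 t}E^{(2)}_{2k-2,\mathfrak t}-\frac{m_2-k}{m_2}E^{(2)}_{2k+2,\mathfrak t}.$$
   Context: Notation: $\mathbb H$ is the upper half-plane with coordinate $\tau$, $h'=\frac{1}{2\pi i}\frac{dh}{d\tau}$, and $q=e^{2\pi i\tau}$. The triangle group of type $\mathfrak t=(m_1,m_2,\infty)$ is the discrete subgroup of $\mathrm{PSL}(2,\mathbb R)$ attached to a hyperbolic triangle with angles $\pi/m_1,\pi/m_2,0$; its cusp is placed at $i\infty$, with local parameter $q$. Its standard hauptmodul $J_{\mathfrak t}$ takes the values $1$, $0$, $\infty$ at the elliptic point of order $m_1$, the elliptic point of order $m_2$ and the cusp. Put $z=1/(1-J_{\mathfrak t}(\tau))$, so $z\to0$ as $\tau\to i\infty$. Put $a=\frac12\left(1-\frac1{m_1}+\frac1{m_2}\right)$, $b=\frac12\left(1-\frac1{m_1}-\frac1{m_2}\right)$, $c=\frac12\left(1+\frac1{m_1}-\frac1{m_2}\right)$. The generalized Halphen system of type $\mathfrak t$ is $$t_1'=(a-1)(t_1t_2+t_1t_3-t_2t_3)+(b+c-1)t_1^2,$$ $$t_2'=(b-1)(t_2t_3+t_2t_1-t_1t_3)+(a+c-1)t_2^2,$$ $$t_3'=(c-1)(t_3t_1+t_3t_2-t_1t_2)+(a+b-1)t_3^2.$$ Throughout, $t_1,t_2,t_3$ denote the following particular solution (near $i\infty$, continued analytically in $\tau$): $$t_1=\kappa(a-1)z(1-z)^{b-a}\,{}_2F_1(1-a,b;1;z)\,{}_2F_1(2-a,b;2;z),$$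 $$t_2-t_1=\kappa(1-z)^{b-a}\,{}_2F_1(1-a,b;1;z)^2,\qquad t_3-t_1=\kappa z(1-z)^{b-a}\,{}_2F_1(1-a,b;1;z)^2,$$ where ${}_2F_1$ is the Gauss hypergeometric function and the constant $\kappa$ is fixed by requiring $E_{2,\mathfrak t}=1+O(q)$ as $\tau\to i\infty$ for the function $E_{2,\mathfrak t}$ below. Eisenstein series: put $\mathsf x=t_1-t_2$ and $\mathsf y=t_3-t_2$. Define $$E^{(1)}_{2k,\mathfrak t}=\mathsf x\,\mathsf y^{k-1}\ (2\le k\le m_1),\qquad E^{(2)}_{2k,\mathfrak t}=\mathsf x^{k-1}\mathsf y\ (2\le k\le m_2),$$ which are holomorphic automorphic forms of weight $2k$ for the triangle group. For $k=2$ both equal $\mathsf x\mathsf y$, denoted $E_{4,\mathfrak t}$. The holomorphic quasi-automorphic weight-2 Eisenstein series is $$E_{2,\mathfrak t}=\frac{1}{m_1+m_2-m_1m_2}\big(2m_1\mathsf x+2m_2\mathsf y+(m_1+m_2+m_1m_2)\,t_2\big).$$ Convention: a symbol $E^{(\ell)}_{2k+2,\mathfrak t}$ with $k\ge m_\ell$ is given by the same monomial formula; it only occurs with coefficient $0$. *)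

theory Defs
  imports
    "HOL-Complex_Analysis.Complex_Analysis"
    "HOL-Library.Landau_Symbols"
    "HOL-Algebra.Bij"
    "HOL-Algebra.Generated_Groups"
begin

definition uhp :: "complex set" where
  "uhp = {\<tau>. Im \<tau> > 0}"

definition at_i_inf :: "complex filter" where
  "at_i_inf = filtercomap Im at_top"

text \<open>
  \<open>has_D f d \<tau>\<close> means that \<open>f\<close> is complex differentiable at \<open>\<tau>\<close> and that \<open>f'\<close> takes the
  value \<open>d\<close> there, where \<open>f' = (1 / (2 \<pi> \<i>)) df/d\<tau>\<close>.
\<close>
definition has_D :: "(complex \<Rightarrow> complex) \<Rightarrow> complex \<Rightarrow> complex \<Rightarrow> bool" where
  "has_D f d \<tau> \<longleftrightarrow> (f has_field_derivative (2 * of_real pi * \<i> * d)) (at \<tau>)"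


section \<open>Triangle groups with one cusp\<close>

text \<open>
  The hyperbolic triangle has the vertices \<open>vertex1\<close>, \<open>vertex2\<close> and \<open>\<i>\<infinity>\<close>. Its sides are the two
  vertical half-lines above \<open>vertex1\<close> and \<open>vertex2\<close> and an arc of the circle with centre \<open>u\<close> on the
  real axis and radius \<open>R = side_radius m1 m2\<close>. The tangent of this circle at the point \<open>u + R cis \<phi>\<close>
  makes the angle \<open>\<phi>\<close> with the vertical direction, so the angles of the triangle at \<open>vertex1\<close> and
  \<open>vertex2\<close> are \<open>pi / m1\<close> and \<open>pi / m2\<close>. The value of \<open>R\<close> makes the triangle \<open>1/2\<close> wide: the
  reflections in the two vertical sides generate \<open>\<tau> \<mapsto> \<tau> + 1\<close>, and \<open>q = exp (2 \<pi> \<i> \<tau>)\<close> is a local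
  parameter at the cusp. This fixes the triangle up to the horizontal translation \<open>u\<close> and up to a
  reflection in a vertical side, which does not change the group.
\<close>
definition side_radius :: "nat \<Rightarrow> nat \<Rightarrow> real" where
  "side_radius m1 m2 = 1 / (2 * (cos (pi / real m1) + cos (pi / real m2)))"

definition vertex1 :: "nat \<Rightarrow> nat \<Rightarrow> real \<Rightarrow> complex" where
  "vertex1 m1 m2 u = of_real u + of_real (side_radius m1 m2) * cis (pi - pi / real m1)"

definition vertex2 :: "nat \<Rightarrow> nat \<Rightarrow> real \<Rightarrow> complex" where
  "vertex2 m1 m2 u = of_real u + of_real (side_radius m1 m2) * cis (pi / real m2)"

definition line_reflection :: "real \<Rightarrow> complex \<Rightarrow> complex" where
  "line_reflection p = (\<lambda>\<tau>\<in>uhp. 2 * of_real p - cnj \<tau>)"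

definition circle_reflection :: "real \<Rightarrow> real \<Rightarrow> complex \<Rightarrow> complex" where
  "circle_reflection u R = (\<lambda>\<tau>\<in>uhp. of_real u + of_real (R\<^sup>2) / (cnj \<tau> - of_real u))"

text \<open>\<open>PSL(2,\<real>)\<close>, as a group of bijections of the upper half-plane.\<close>
definition PSL2R :: "(complex \<Rightarrow> complex) set" where
  "PSL2R = {\<lambda>\<tau>\<in>uhp. (of_real a * \<tau> + of_real b) / (of_real c * \<tau> + of_real d) |
              a b c d :: real. a * d - b * c = 1}"

text \<open>
  The triangle group: the orientation preserving maps in the group generated by the reflections in
  the three sides of the triangle.
\<close>
definition triangle_group :: "nat \<Rightarrow> nat \<Rightarrow> real \<Rightarrow> (complex \<Rightarrow> complex) set" where
  "triangle_group m1 m2 u =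
     generate (BijGroup uhp)
       {line_reflection (Re (vertex1 m1 m2 u)),
        line_reflection (Re (vertex2 m1 m2 u)),
        circle_reflection u (side_radius m1 m2)} \<inter> PSL2R"

text \<open>
  The standard hauptmodul: \<open>J\<close> induces a bijection from the orbits in the upper half-plane
  (completed by the cusp) to the Riemann sphere, with the normalisation \<open>1\<close>, \<open>0\<close>, \<open>\<infinity>\<close> at the
  vertices.
\<close>
definition standard_hauptmodul :: "nat \<Rightarrow> nat \<Rightarrow> real \<Rightarrow> (complex \<Rightarrow> complex) \<Rightarrow> bool" where
  "standard_hauptmodul m1 m2 u J \<longleftrightarrow>
     J holomorphic_on uhp \<and>
     (\<forall>\<tau>\<in>uhp. \<forall>\<sigma>\<in>uhp. J \<tau> = J \<sigma> \<longleftrightarrow> (\<exists>g\<in>triangle_group m1 m2 u. \<sigma> = g \<tau>)) \<and>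
     J ` uhp = UNIV \<and>
     J (vertex1 m1 m2 u) = 1 \<and>
     J (vertex2 m1 m2 u) = 0 \<and>
     filterlim J at_infinity at_i_inf"


section \<open>The Halphen system and its particular solution\<close>

definition hal_a :: "nat \<Rightarrow> nat \<Rightarrow> complex" where
  "hal_a m1 m2 = (1 - 1 / of_nat m1 + 1 / of_nat m2) / 2"

definition hal_b :: "nat \<Rightarrow> nat \<Rightarrow> complex" where
  "hal_b m1 m2 = (1 - 1 / of_nat m1 - 1 / of_nat m2) / 2"

definition hal_c :: "nat \<Rightarrow> nat \<Rightarrow> complex" where
  "hal_c m1 m2 = (1 + 1 / of_nat m1 - 1 / of_nat m2) / 2"

text \<open>
  The continuation of the particular solution to the upper half-plane is meromorphic, with poles at
  elliptic points. For type \<open>(2,3,\<infinity>)\<close>, for example, \<open>t1 - t2 = E6 / E4\<close> and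
  \<open>t3 - t2 = E4^2 / E6\<close> for the classical Eisenstein series.
\<close>
definition halphen_solution ::
  "nat \<Rightarrow> nat \<Rightarrow> (complex \<Rightarrow> complex) \<Rightarrow> (complex \<Rightarrow> complex) \<Rightarrow> (complex \<Rightarrow> complex) \<Rightarrow> bool" where
  "halphen_solution m1 m2 t1 t2 t3 \<longleftrightarrow>
     t1 meromorphic_on uhp \<and> t2 meromorphic_on uhp \<and> t3 meromorphic_on uhp \<and>
     (let a = hal_a m1 m2; b = hal_b m1 m2; c = hal_c m1 m2 in
      \<forall>\<tau>\<in>uhp. t1 analytic_on {\<tau>} \<and> t2 analytic_on {\<tau>} \<and> t3 analytic_on {\<tau>} \<longrightarrow>
        has_D t1 ((a - 1) * (t1 \<tau> * t2 \<tau> + t1 \<tau> * t3 \<tau> - t2 \<tau> * t3 \<tau>) + (b + c - 1) * (t1 \<tau>)\<^sup>2) \<tau> \<and>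
        has_D t2 ((b - 1) * (t2 \<tau> * t3 \<tau> + t2 \<tau> * t1 \<tau> - t1 \<tau> * t3 \<tau>) + (a + c - 1) * (t2 \<tau>)\<^sup>2) \<tau> \<and>
        has_D t3 ((c - 1) * (t3 \<tau> * t1 \<tau> + t3 \<tau> * t2 \<tau> - t1 \<tau> * t2 \<tau>) + (a + b - 1) * (t3 \<tau>)\<^sup>2) \<tau>)"

definition hyp2F1 :: "complex \<Rightarrow> complex \<Rightarrow> complex \<Rightarrow> complex \<Rightarrow> complex" where
  "hyp2F1 a b c z = eval_fps (fps_hypergeo [a, b] [c] 1) z"

text \<open>
  The expressions for \<open>t1\<close>, \<open>t2\<close>, \<open>t3\<close> near \<open>\<i>\<infinity>\<close>, where \<open>z\<close> is close to \<open>0\<close>, so that the principal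
  branch of the power is the right one.
\<close>
definition hypergeometric_at_cusp ::
  "nat \<Rightarrow> nat \<Rightarrow> (complex \<Rightarrow> complex) \<Rightarrow> complex \<Rightarrow>
     (complex \<Rightarrow> complex) \<Rightarrow> (complex \<Rightarrow> complex) \<Rightarrow> (complex \<Rightarrow> complex) \<Rightarrow> bool" where
  "hypergeometric_at_cusp m1 m2 J \<kappa> t1 t2 t3 \<longleftrightarrow>
     (let a = hal_a m1 m2; b = hal_b m1 m2 in
      \<forall>\<^sub>F \<tau> in at_i_inf.
        let z = 1 / (1 - J \<tau>); F = hyp2F1 (1 - a) b 1 z in
          t1 \<tau> = \<kappa> * (a - 1) * z * (1 - z) powr (b - a) * F * hyp2F1 (2 - a) b 2 z \<and>
          t2 \<tau> - t1 \<tau> = \<kappa> * (1 - z) powr (b - a) * F\<^sup>2 \<and>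
          t3 \<tau> - t1 \<tau> = \<kappa> * z * (1 - z) powr (b - a) * F\<^sup>2)"


section \<open>Eisenstein series\<close>

text \<open>
  The functions \<open>t1\<close>, \<open>t2\<close>, \<open>t3\<close> have poles, while the Eisenstein series are holomorphic on the
  upper half-plane; \<^const>\<open>remove_sings\<close> fills in the removable singularities of the defining
  expressions. The series \<open>eis1 t1 t2 t3 k\<close> and \<open>eis2 t1 t2 t3 k\<close> have weight \<open>2 k\<close>.
\<close>
definition eis1 ::
  "(complex \<Rightarrow> complex) \<Rightarrow> (complex \<Rightarrow> complex) \<Rightarrow> (complex \<Rightarrow> complex) \<Rightarrow> nat \<Rightarrow> complex \<Rightarrow> complex" where
  "eis1 t1 t2 t3 k = remove_sings (\<lambda>\<tau>. (t1 \<tau> - t2 \<tau>) * (t3 \<tau> - t2 \<tau>) ^ (k - 1))"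

definition eis2 ::
  "(complex \<Rightarrow> complex) \<Rightarrow> (complex \<Rightarrow> complex) \<Rightarrow> (complex \<Rightarrow> complex) \<Rightarrow> nat \<Rightarrow> complex \<Rightarrow> complex" where
  "eis2 t1 t2 t3 k = remove_sings (\<lambda>\<tau>. (t1 \<tau> - t2 \<tau>) ^ (k - 1) * (t3 \<tau> - t2 \<tau>))"

definition eis_E4 ::
  "(complex \<Rightarrow> complex) \<Rightarrow> (complex \<Rightarrow> complex) \<Rightarrow> (complex \<Rightarrow> complex) \<Rightarrow> complex \<Rightarrow> complex" where
  "eis_E4 t1 t2 t3 = remove_sings (\<lambda>\<tau>. (t1 \<tau> - t2 \<tau>) * (t3 \<tau> - t2 \<tau>))"

definition eis_E2 ::
  "nat \<Rightarrow> nat \<Rightarrow> (complex \<Rightarrow> complex) \<Rightarrow> (complex \<Rightarrow> complex) \<Rightarrow> (complex \<Rightarrow> complex) \<Rightarrow> complex \<Rightarrow> complex" where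
  "eis_E2 m1 m2 t1 t2 t3 = remove_sings (\<lambda>\<tau>.
     1 / (of_nat m1 + of_nat m2 - of_nat m1 * of_nat m2) *
       (2 * of_nat m1 * (t1 \<tau> - t2 \<tau>) + 2 * of_nat m2 * (t3 \<tau> - t2 \<tau>) +
        (of_nat m1 + of_nat m2 + of_nat m1 * of_nat m2) * t2 \<tau>))"

end

theory Submission
  imports Defs "HOL-Real_Asymp.Real_Asymp"
begin

text \<open>
  Put \<open>x = t1 - t2\<close>, \<open>y = t3 - t2\<close>. Wherever \<open>t1\<close>, \<open>t2\<close>, \<open>t3\<close> are analytic, the identities are polynomial
  consequences of the Halphen system; the point is that they persist at the poles, i.e. that the
  Eisenstein series are holomorphic. The expansion at the cusp and the identity theorem give
  \<open>(t3 - t1) (1 - J) = t2 - t1\<close>, from which the Halphen system yields \<open>x = - J' / J\<close> and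
  \<open>y = - J' / (J - 1)\<close>. Hence \<open>(1 - 1/m1 - 1/m2) E2 = J''/J' - (1 - 1/m2) J'/J - (1 - 1/m1) J'/(J - 1)\<close>
  has at most simple poles, and the Riccati equation for \<open>E2\<close> leaves only \<open>0\<close> as possible residue. Vanishing of
  the residue at the zeros of \<open>J\<close> and \<open>J - 1\<close> says that their orders are \<open>m2\<close> and \<open>m1\<close>, so the
  orders of \<open>x\<^sup>i y\<^sup>j\<close> can be read off.
\<close>

section \<open>Local orders of the hauptmodul\<close>

text \<open>A punctured neighbourhood is open, so an identity valid near \<open>z0\<close> but off
  \<open>z0\<close> holds in a full neighbourhood of each such point and may be differentiated
  there.\<close>

lemma eventually_at_imp_eventually_nhds:
  fixes z0 :: "'a :: t1_space"
  assumes "\<forall>\<^sub>F z in at z0. P z"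
  shows "\<forall>\<^sub>F z in at z0. \<forall>\<^sub>F w in nhds z. P w"
proof -
  obtain A where A: "open A" "z0 \<in> A" "\<And>z. z \<in> A - {z0} \<Longrightarrow> P z"
    using assms unfolding eventually_at_topological by blast
  have "\<forall>\<^sub>F z in at z0. z \<in> A - {z0}"
    using A(1,2) by (intro eventually_at_in_open)
  then show ?thesis
  proof eventually_elim
    case (elim z)
    have "\<forall>\<^sub>F w in nhds z. w \<in> A - {z0}"
      using elim A(1) by (intro eventually_nhds_in_open) auto
    then show ?case
      by eventually_elim (use A(3) in auto)
  qed
qed

lemma eventually_nhds_imp_at: "\<forall>\<^sub>F z in nhds a. P z \<Longrightarrow> \<forall>\<^sub>F z in at a. P z"
  by (simp add: eventually_at_filter eventually_mono)

section \<open>Factorisations at a point and logarithmic derivatives\<close>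

lemma analytic_factor:
  assumes f: "f analytic_on {z0}" and ne: "\<forall>\<^sub>F z in at z0. f z \<noteq> f z0"
  obtains N g where "N > 0" "g analytic_on {z0}" "g z0 \<noteq> 0"
    "\<forall>\<^sub>F z in nhds z0. f z - f z0 = (z - z0) ^ N * g z"
proof -
  obtain r where r: "r > 0" "f holomorphic_on ball z0 r"
    using f by (auto simp: analytic_on_def)
  have nc: "\<not> (\<lambda>z. f z - f z0) constant_on ball z0 r"
  proof
    assume c: "(\<lambda>z. f z - f z0) constant_on ball z0 r"
    have "f z = f z0" if "z \<in> ball z0 r" for z
      using c that r(1) unfolding constant_on_def by (metis centre_in_ball right_minus_eq)
    moreover have "\<forall>\<^sub>F z in at z0. z \<in> ball z0 r"
      using r(1) by (intro eventually_at_in_open') auto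
    ultimately have "\<forall>\<^sub>F z in at z0. f z = f z0"
      by (auto elim: eventually_mono)
    with ne have "\<forall>\<^sub>F z in at z0. False"
      by eventually_elim auto
    then show False by simp
  qed
  have hol: "(\<lambda>z. f z - f z0) holomorphic_on ball z0 r"
    by (intro holomorphic_intros r)
  have "z0 \<in> ball z0 r" "f z0 - f z0 = 0" using r(1) by auto
  then obtain g e N where "N > 0" "e > 0" "ball z0 e \<subseteq> ball z0 r" and
    g: "g holomorphic_on ball z0 e" "\<And>w. w \<in> ball z0 e \<Longrightarrow> f w - f z0 = (w - z0) ^ N * g w"
       "\<And>w. w \<in> ball z0 e \<Longrightarrow> g w \<noteq> 0"
    by (rule holomorphic_factor_zero_nonconstant[OF hol open_ball connected_ball _ _ nc]) blast
  show ?thesis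
  proof (rule that[OF \<open>N > 0\<close>])
    show "g analytic_on {z0}" using g(1) \<open>e > 0\<close> by (auto simp: analytic_on_def)
    show "g z0 \<noteq> 0" using g(3) \<open>e > 0\<close> by auto
    have "\<forall>\<^sub>F z in nhds z0. z \<in> ball z0 e"
      using \<open>e > 0\<close> by (intro eventually_nhds_in_open) auto
    then show "\<forall>\<^sub>F z in nhds z0. f z - f z0 = (z - z0) ^ N * g z"
      by eventually_elim (rule g(2))
  qed
qed

lemma analytic_at_eventually:
  "f analytic_on {z0} \<Longrightarrow> \<forall>\<^sub>F z in nhds z0. f analytic_on {z}"
  by (metis analytic_at eventually_nhds)

lemma deriv_power_mult:
  assumes f: "\<forall>\<^sub>F z in nhds z0. f z = (z - z0) ^ Suc n * g z" and g: "g analytic_on {z0}"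
  shows "\<forall>\<^sub>F z in nhds z0. deriv f z = (z - z0) ^ n * (of_nat (Suc n) * g z + (z - z0) * deriv g z)"
proof -
  have "\<forall>\<^sub>F z in nhds z0. \<forall>\<^sub>F w in nhds z. f w = (w - z0) ^ Suc n * g w"
    using f by (simp add: eventually_eventually)
  with analytic_at_eventually[OF g] show ?thesis
  proof eventually_elim
    case (elim z)
    have *: "(g has_field_derivative deriv g z) (at z)"
      using elim(1) by (simp add: analytic_derivI)
    have "((\<lambda>w. w - z0) has_field_derivative 1) (at z)"
      by (auto intro!: derivative_eq_intros)
    note ** = DERIV_mult[OF DERIV_power_Suc[OF this, of n] *]
    have "deriv f z = deriv (\<lambda>w. (w - z0) ^ Suc n * g w) z"
      using elim(2) by (rule deriv_cong_ev) simp
    also have "\<dots> = (z - z0) ^ n * (of_nat (Suc n) * g z + (z - z0) * deriv g z)"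
      using DERIV_imp_deriv[OF **] by (simp add: algebra_simps)
    finally show ?case .
  qed
qed

lemma logderiv_factor:
  assumes f: "\<forall>\<^sub>F z in nhds z0. f z = (z - z0) ^ n * g z"
    and g: "g analytic_on {z0}" "g z0 \<noteq> 0"
  shows "\<forall>\<^sub>F z in at z0. deriv f z / f z = of_nat n / (z - z0) + deriv g z / g z"
proof -
  have nz: "\<forall>\<^sub>F z in at z0. g z \<noteq> 0 \<and> z \<noteq> z0"
    using analytic_at_neq_imp_eventually_neq[OF g] by (auto simp: eventually_conj_iff eventually_at_filter)
  show ?thesis
  proof (cases n)
    \<comment> \<open>The product rule for \<open>deriv\<close> above carries the exponent
      \<open>Suc n\<close>; for exponent \<open>0\<close> the function is \<open>g\<close> itself
      near \<open>z0\<close>.\<close>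
    case 0
    have "\<forall>\<^sub>F z in nhds z0. \<forall>\<^sub>F w in nhds z. f w = g w"
      using f 0 by (simp add: eventually_eventually)
    then have "\<forall>\<^sub>F z in nhds z0. deriv f z / f z = deriv g z / g z"
    proof eventually_elim
      case (elim z)
      then show ?case
        using deriv_cong_ev[OF elim refl] eventually_nhds_x_imp_x[OF elim] by simp
    qed
    then show ?thesis using 0 eventually_nhds_imp_at by simp
  next
    case (Suc k)
    have "\<forall>\<^sub>F z in at z0. deriv f z = (z - z0) ^ k * (of_nat (Suc k) * g z + (z - z0) * deriv g z)"
      using deriv_power_mult[OF f[unfolded Suc] g(1)] by (rule eventually_nhds_imp_at)
    with eventually_nhds_imp_at[OF f] nz show ?thesis
    proof eventually_elim
      case (elim z)
      then have "z - z0 \<noteq> 0" "g z \<noteq> 0" by auto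
      with elim show ?case
        by (simp add: Suc divide_simps del: of_nat_Suc)
    qed
  qed
qed

text \<open>No differentiability is assumed: \<open>f\<close> and its translate admit the same
  derivatives at every point, so \<open>deriv\<close> makes the same choice for both.\<close>

lemma deriv_minus_const: "deriv (\<lambda>z. f z - c) = deriv (f :: complex \<Rightarrow> complex)"
proof -
  have "((\<lambda>z. f z - c) has_field_derivative D) (at z) \<longleftrightarrow> (f has_field_derivative D) (at z)" for D z
    using DERIV_diff[of f D z UNIV "\<lambda>_. c" 0]
      DERIV_add[of "\<lambda>z. f z - c" D z UNIV "\<lambda>_. c" 0] by auto
  then show ?thesis
    by (simp add: fun_eq_iff deriv_def)
qed

text \<open>\<open>J\<close> and \<open>J - 1\<close> have no common zero, and whichever vanishes at
  \<open>z0\<close> has order one more than \<open>J'\<close>. Where neither vanishes,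
  \<open>n2\<close> is unconstrained: critical points of \<open>J\<close> are not excluded at this
  stage.\<close>

lemma local_orders:
  fixes J :: "complex \<Rightarrow> complex"
  assumes J: "J analytic_on {z0}" and ne: "\<forall>\<^sub>F z in at z0. J z \<noteq> J z0"
  obtains n0 n1 n2 :: nat and g0 g1 g2 where
    "g0 analytic_on {z0}" "g0 z0 \<noteq> 0" "\<forall>\<^sub>F z in nhds z0. J z = (z - z0) ^ n0 * g0 z"
    "g1 analytic_on {z0}" "g1 z0 \<noteq> 0" "\<forall>\<^sub>F z in nhds z0. J z - 1 = (z - z0) ^ n1 * g1 z"
    "g2 analytic_on {z0}" "g2 z0 \<noteq> 0" "\<forall>\<^sub>F z in nhds z0. deriv J z = (z - z0) ^ n2 * g2 z"
    "n0 = 0 \<and> n1 = 0 \<or> n0 = Suc n2 \<and> n1 = 0 \<or> n0 = 0 \<and> n1 = Suc n2"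
proof -
  obtain N g where N: "N > 0" and g: "g analytic_on {z0}" "g z0 \<noteq> 0"
    and eq: "\<forall>\<^sub>F z in nhds z0. J z - J z0 = (z - z0) ^ N * g z"
    using analytic_factor[OF J ne] by blast
  obtain n where n: "N = Suc n" using N by (cases N) auto
  \<comment> \<open>At \<open>z0\<close> only \<open>of_nat (Suc n) * g z0\<close> survives, so
    \<open>n\<close> is the exact order of \<open>J'\<close>.\<close>
  define h where "h = (\<lambda>z. of_nat (Suc n) * g z + (z - z0) * deriv g z)"
  have h: "\<forall>\<^sub>F z in nhds z0. deriv J z = (z - z0) ^ n * h z"
    using deriv_power_mult[OF eq[unfolded n] g(1)] by (simp add: h_def deriv_minus_const)
  have h2: "h analytic_on {z0}" "h z0 \<noteq> 0"
    using g by (auto simp: h_def intro!: analytic_intros simp del: of_nat_Suc)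
  have J1: "(\<lambda>z. J z - 1) analytic_on {z0}" by (intro analytic_intros J)
  consider "J z0 = 0" | "J z0 = 1" | "J z0 \<noteq> 0" "J z0 \<noteq> 1" by blast
  then show ?thesis
  proof cases
    case 1
    show ?thesis
      by (rule that[of g N "\<lambda>z. J z - 1" 0 h n]) (use 1 g eq h h2 J1 n in simp_all)
  next
    case 2
    show ?thesis
      by (rule that[of J 0 g N h n]) (use 2 g eq h h2 J n in simp_all)
  next
    case 3
    show ?thesis
      by (rule that[of J 0 "\<lambda>z. J z - 1" 0 h n]) (use 3 h h2 J J1 in simp_all)
  qed
qed

text \<open>The logarithmic derivatives give \<open>E\<close> at most a simple pole, whose residue
  is determined by the orders of \<open>J\<close>, \<open>J - 1\<close> and \<open>J'\<close>. Once
  it vanishes, \<open>J\<close> has order \<open>m2\<close> at its zeros and \<open>J - 1\<close>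
  has order \<open>m1\<close> at its zeros. There \<open>J'/J\<close> and \<open>J'/(J - 1)\<close>
  have orders \<open>-1\<close> and \<open>m2 - 1\<close>, respectively \<open>m1 - 1\<close> and
  \<open>-1\<close>, and the two inequalities on \<open>i\<close> and \<open>j\<close> say that the
  monomial has nonnegative order.\<close>

lemma
  fixes J E :: "complex \<Rightarrow> complex" and K :: complex and m1 m2 :: nat
  assumes J: "J analytic_on {z0}" and ne: "\<forall>\<^sub>F z in at z0. J z \<noteq> J z0"
    and m: "m1 > 0" "m2 > 0"
    and E: "\<forall>\<^sub>F z in at z0. E z = deriv (deriv J) z / deriv J z
        - (1 - 1 / of_nat m2) * (deriv J z / J z) - (1 - 1 / of_nat m1) * (deriv J z / (J z - 1))"
    and E': "\<forall>\<^sub>F z in at z0. (E has_field_derivative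
        ((E z)\<^sup>2 - K * (deriv J z / J z) * (deriv J z / (J z - 1))) / 2) (at z)"
  shows riccati_regular: "\<exists>H. H analytic_on {z0} \<and> (\<forall>\<^sub>F z in at z0. E z = H z)"
    and monomial_regular: "i \<le> j * (m2 - 1) \<Longrightarrow> j \<le> i * (m1 - 1) \<Longrightarrow>
      \<exists>H. H analytic_on {z0} \<and> (\<forall>\<^sub>F z in at z0. (deriv J z / J z) ^ i * (deriv J z / (J z - 1)) ^ j = H z)"
proof -
  obtain n0 n1 n2 g0 g1 g2 where
    g0: "g0 analytic_on {z0}" "g0 z0 \<noteq> 0" "\<forall>\<^sub>F z in nhds z0. J z = (z - z0) ^ n0 * g0 z" and
    g1: "g1 analytic_on {z0}" "g1 z0 \<noteq> 0" "\<forall>\<^sub>F z in nhds z0. J z - 1 = (z - z0) ^ n1 * g1 z" and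
    g2: "g2 analytic_on {z0}" "g2 z0 \<noteq> 0" "\<forall>\<^sub>F z in nhds z0. deriv J z = (z - z0) ^ n2 * g2 z" and
    n: "n0 = 0 \<and> n1 = 0 \<or> n0 = Suc n2 \<and> n1 = 0 \<or> n0 = 0 \<and> n1 = Suc n2"
    by (rule local_orders[OF J ne])
  define l where "l = (\<lambda>g z :: complex. deriv g z / g z :: complex)"
  have l_an: "l g0 analytic_on {z0}" "l g1 analytic_on {z0}" "l g2 analytic_on {z0}"
    unfolding l_def using g0 g1 g2 by (auto intro!: analytic_intros)
  have l0: "\<forall>\<^sub>F z in at z0. deriv J z / J z = of_nat n0 / (z - z0) + l g0 z"
    using logderiv_factor[OF g0(3,1,2)] by (simp add: l_def)
  have l1: "\<forall>\<^sub>F z in at z0. deriv J z / (J z - 1) = of_nat n1 / (z - z0) + l g1 z"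
    using logderiv_factor[OF g1(3,1,2)] by (simp add: l_def deriv_minus_const)
  have l2: "\<forall>\<^sub>F z in at z0. deriv (deriv J) z / deriv J z = of_nat n2 / (z - z0) + l g2 z"
    using logderiv_factor[OF g2(3,1,2)] by (simp add: l_def)
  define \<rho> :: complex
    where "\<rho> = of_nat n2 - (1 - 1 / of_nat m2) * of_nat n0 - (1 - 1 / of_nat m1) * of_nat n1"
  define H where "H = (\<lambda>z. l g2 z - (1 - 1 / of_nat m2) * l g0 z - (1 - 1 / of_nat m1) * l g1 z)"
  have H: "H analytic_on {z0}"
    unfolding H_def by (intro analytic_intros l_an)
  have ne0: "\<forall>\<^sub>F z in at z0. z \<noteq> z0" by (simp add: eventually_at_filter)
  have EH: "\<forall>\<^sub>F z in at z0. E z = \<rho> / (z - z0) + H z"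
    using E l0 l1 l2 ne0
  proof eventually_elim
    case (elim z)
    show ?case
      unfolding elim(1-4) \<rho>_def H_def by (simp add: divide_inverse algebra_simps)
  qed
  txt \<open>
    Comparing the coefficients of \<open>(z - z0)\<^sup>-\<^sup>2\<close> in the Riccati equation leaves only
    \<open>\<rho> = 0\<close> and \<open>\<rho> = -2\<close>; the latter is too negative for the orders of \<open>J\<close>.
  \<close>
  define P where "P = (\<lambda>z. (z - z0)\<^sup>2 * deriv H z - \<rho>)"
  define Q where "Q = (\<lambda>z. ((\<rho> + (z - z0) * H z)\<^sup>2
     - K * (of_nat n0 + (z - z0) * l g0 z) * (of_nat n1 + (z - z0) * l g1 z)) / 2)"
  have "\<forall>\<^sub>F z in at z0. P z = Q z"
    using E' l0 l1 EH eventually_at_imp_eventually_nhds[OF EH] ne0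
      eventually_nhds_imp_at[OF analytic_at_eventually[OF H]]
  proof eventually_elim
    case (elim z)
    have *: "((\<lambda>w. \<rho> / (w - z0) + H w) has_field_derivative - (\<rho> / (z - z0)\<^sup>2) + deriv H z) (at z)"
      using elim(6) analytic_derivI[OF elim(7)]
      by (auto intro!: derivative_eq_intros simp: power2_eq_square)
    have "(E has_field_derivative - (\<rho> / (z - z0)\<^sup>2) + deriv H z) (at z)"
      using * DERIV_cong_ev[OF refl elim(5) refl] by simp
    then have eq: "- (\<rho> / (z - z0)\<^sup>2) + deriv H z =
        ((\<rho> / (z - z0) + H z)\<^sup>2 - K * (of_nat n0 / (z - z0) + l g0 z) * (of_nat n1 / (z - z0) + l g1 z)) / 2"
      using DERIV_unique[OF elim(1)] unfolding elim(2-4) by metis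
    have s: "z - z0 \<noteq> 0" using elim(6) by simp
    have scale: "a\<^sup>2 * ((b\<^sup>2 - K * c * d) / 2) = ((a * b)\<^sup>2 - K * (a * c) * (a * d)) / 2" for a b c d
      by (simp add: power2_eq_square algebra_simps)
    have "P z = (z - z0)\<^sup>2 * (- (\<rho> / (z - z0)\<^sup>2) + deriv H z)"
      using s by (simp add: P_def algebra_simps)
    also have "\<dots> = (((z - z0) * (\<rho> / (z - z0) + H z))\<^sup>2
       - K * ((z - z0) * (of_nat n0 / (z - z0) + l g0 z)) * ((z - z0) * (of_nat n1 / (z - z0) + l g1 z))) / 2"
      unfolding eq by (rule scale)
    also have "\<dots> = Q z"
      using s by (simp add: Q_def distrib_left)
    finally show ?case .
  qed
  \<comment> \<open>Clearing the double pole makes both sides continuous at \<open>z0\<close>, with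
    values \<open>- \<rho>\<close> and \<open>(\<rho>^2 - K * n0 * n1) / 2\<close>. The product
    \<open>n0 * n1\<close> is \<open>0\<close> because \<open>J\<close> and \<open>J - 1\<close>
    have no common zero.\<close>
  moreover have "P \<midarrow>z0\<rightarrow> P z0" "Q \<midarrow>z0\<rightarrow> Q z0"
    by (intro isContD analytic_at_imp_isCont; unfold P_def Q_def; intro analytic_intros H l_an; simp)+
  ultimately have "P z0 = Q z0"
    using tendsto_unique[OF trivial_limit_at] Lim_transform_eventually by metis
  moreover have "of_nat n0 * of_nat n1 = (0 :: complex)" using n by auto
  ultimately have "- (\<rho> * 2) = \<rho> * \<rho>"
    by (auto simp: P_def Q_def power2_eq_square algebra_simps)
  then have "\<rho> * (\<rho> + 2) = 0"
    by (metis add.left_inverse add.commute distrib_left)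
  moreover have "\<rho> + 2 \<noteq> 0"
  proof
    assume "\<rho> + 2 = 0"
    moreover have "\<rho> + 2 = of_real (real n2 + 2 - (1 - 1 / real m2) * real n0 - (1 - 1 / real m1) * real n1)"
      by (simp add: \<rho>_def)
    ultimately have "real n2 + 2 - (1 - 1 / real m2) * real n0 - (1 - 1 / real m1) * real n1 = 0"
      using of_real_eq_0_iff by metis
    \<comment> \<open>For \<open>n0 = Suc n2\<close> the sum is \<open>1 + (1 + n2) / m2\<close>,
      for \<open>n1 = Suc n2\<close> it is \<open>1 + (1 + n2) / m1\<close>, otherwise it is
      \<open>n2 + 2\<close>; each is positive.\<close>
    moreover have "1 + (1 + real n2) / real m \<noteq> 0" for m
      using divide_nonneg_nonneg[of "1 + real n2" "real m"] by linarith
    ultimately show False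
      using n by (auto simp: algebra_simps)
  qed
  ultimately have \<rho>: "\<rho> = 0" by simp
  then show "\<exists>H. H analytic_on {z0} \<and> (\<forall>\<^sub>F z in at z0. E z = H z)"
    using EH H by auto
  \<comment> \<open>Now \<open>\<rho> = 0\<close> reads \<open>n2 = (1 - 1 / m2) * Suc n2\<close>,
    that is \<open>Suc n2 = m2\<close>; the zeros of \<open>J - 1\<close> are treated in the same
    way.\<close>
  have n0: "n0 = m2" if "n0 = Suc n2"
  proof -
    have "complex_of_nat (Suc n2) / of_nat m2 = 1"
      using \<rho> that n by (auto simp: \<rho>_def algebra_simps add_divide_distrib)
    then show ?thesis
      using that m of_nat_eq_iff[where 'a = complex] by (simp add: divide_eq_1_iff del: of_nat_Suc)
  qed
  have n1: "n1 = m1" if "n1 = Suc n2"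
  proof -
    have "complex_of_nat (Suc n2) / of_nat m1 = 1"
      using \<rho> that n by (auto simp: \<rho>_def algebra_simps add_divide_distrib)
    then show ?thesis
      using that m of_nat_eq_iff[where 'a = complex] by (simp add: divide_eq_1_iff del: of_nat_Suc)
  qed
  assume ij: "i \<le> j * (m2 - 1)" "j \<le> i * (m1 - 1)"
  \<comment> \<open>The numerator of the monomial vanishes to order \<open>(i + j) * n2\<close>, the
    denominator to order \<open>i * n0 + j * n1\<close>; the excess \<open>e\<close> is the order of
    the monomial at \<open>z0\<close>.\<close>
  have "i * n0 + j * n1 \<le> (i + j) * n2"
    using n
  proof (elim disjE)
    assume *: "n0 = Suc n2 \<and> n1 = 0"
    then have "m2 = Suc n2" using n0 by simp
    then show ?thesis using * ij by (simp add: algebra_simps)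
  next
    assume *: "n0 = 0 \<and> n1 = Suc n2"
    then have "m1 = Suc n2" using n1 by simp
    then show ?thesis using * ij by (simp add: algebra_simps)
  qed simp
  then obtain e where e: "(i + j) * n2 = i * n0 + j * n1 + e"
    using le_Suc_ex by blast
  define M where "M = (\<lambda>z. (z - z0) ^ e * (g2 z / g0 z) ^ i * (g2 z / g1 z) ^ j)"
  have "\<forall>\<^sub>F z in at z0. (deriv J z / J z) ^ i * (deriv J z / (J z - 1)) ^ j = M z"
    using eventually_nhds_imp_at[OF g0(3)] eventually_nhds_imp_at[OF g1(3)]
      eventually_nhds_imp_at[OF g2(3)] ne0
  proof eventually_elim
    case (elim z)
    define s where "s = z - z0"
    have s: "s \<noteq> 0" using elim(4) by (simp add: s_def)
    have "(deriv J z / J z) ^ i * (deriv J z / (J z - 1)) ^ j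
        = (s ^ n2 * g2 z) ^ (i + j) / ((s ^ n0 * g0 z) ^ i * (s ^ n1 * g1 z) ^ j)"
      unfolding elim(2,3) unfolding elim(1) s_def by (simp add: power_divide power_add)
    also have "\<dots> = s ^ ((i + j) * n2) / s ^ (i * n0 + j * n1) * (g2 z / g0 z) ^ i * (g2 z / g1 z) ^ j"
      by (simp add: power_mult_distrib power_add power_divide add_mult_distrib2 mult_ac flip: power_mult)
    also have "\<dots> = M z"
      using s by (simp add: e M_def power_add s_def)
    finally show ?case .
  qed
  moreover have "M analytic_on {z0}"
    unfolding M_def using g0 g1 g2 by (auto intro!: analytic_intros)
  ultimately show "\<exists>H. H analytic_on {z0} \<and>
      (\<forall>\<^sub>F z in at z0. (deriv J z / J z) ^ i * (deriv J z / (J z - 1)) ^ j = H z)"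
    by blast
qed

section \<open>The Halphen system and its hauptmodul\<close>

lemma open_uhp: "open uhp"
  unfolding uhp_def by (rule open_halfspace_Im_gt)

lemma connected_uhp: "connected uhp"
  unfolding uhp_def by (intro convex_connected convex_halfspace_Im_gt)

section \<open>The normalised derivative and removable singularities\<close>

lemma has_D_eq: "has_D f d z \<Longrightarrow> d = e \<Longrightarrow> has_D f e z"
  by simp

lemma has_D_const_mult: "has_D f d z \<Longrightarrow> has_D (\<lambda>w. c * f w) (c * d) z"
  unfolding has_D_def by (auto intro!: derivative_eq_intros)

lemma has_D_diff: "has_D f d z \<Longrightarrow> has_D g e z \<Longrightarrow> has_D (\<lambda>w. f w - g w) (d - e) z"
  unfolding has_D_def by (auto intro!: derivative_eq_intros simp: algebra_simps)

lemma has_D_monomial: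
  assumes "has_D f d z" "has_D g e z"
  shows "has_D (\<lambda>w. f w ^ i * g w ^ j)
    (of_nat i * f z ^ (i - 1) * d * g z ^ j + f z ^ i * (of_nat j * g z ^ (j - 1) * e)) z"
  using assms unfolding has_D_def by (auto intro!: derivative_eq_intros simp: algebra_simps)

lemma has_D_cong:
  assumes "\<forall>\<^sub>F w in nhds z. f w = g w"
  shows "has_D f d z \<longleftrightarrow> has_D g d z"
  unfolding has_D_def by (rule DERIV_cong_ev[OF refl assms refl])

text \<open>\<open>deriv F\<close> and \<open>G\<close> are continuous at \<open>z0\<close>, so the
  equation passes to the limit. In this way the differential equations cross the poles of
  \<open>t1\<close>, \<open>t2\<close>, \<open>t3\<close>.\<close>

lemma has_D_extend:
  assumes F: "F analytic_on {z0}" and G: "G analytic_on {z0}"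
    and FG: "\<forall>\<^sub>F z in at z0. has_D F (G z) z"
  shows "has_D F (G z0) z0"
proof -
  have "\<forall>\<^sub>F z in at z0. deriv F z = 2 * of_real pi * \<i> * G z"
    using FG by eventually_elim (auto simp: has_D_def intro: DERIV_imp_deriv)
  moreover have "deriv F \<midarrow>z0\<rightarrow> deriv F z0"
    by (intro isContD analytic_at_imp_isCont analytic_deriv F)
  moreover have "(\<lambda>z. 2 * of_real pi * \<i> * G z) \<midarrow>z0\<rightarrow> 2 * of_real pi * \<i> * G z0"
    by (intro isContD analytic_at_imp_isCont analytic_intros G)
  ultimately have "deriv F z0 = 2 * of_real pi * \<i> * G z0"
    using tendsto_unique[OF trivial_limit_at] Lim_transform_eventually by metis
  then show ?thesis
    using analytic_derivI[OF F] by (simp add: has_D_def)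
qed

lemma remove_sings_eventually_eq:
  assumes "\<forall>\<^sub>F z in at z0. f z = F z" "F analytic_on {z0}"
  shows "remove_sings f z0 = F z0"
  using remove_sings_cong[OF assms(1) refl] remove_sings_at_analytic[OF assms(2)] by simp

text \<open>Analyticity needs agreement with \<open>F\<close> on a whole neighbourhood: at each
  point near \<open>z0\<close> the filled-in value is again a limit of values of
  \<open>F\<close>.\<close>

lemma remove_sings_eventually_analytic:
  assumes "\<forall>\<^sub>F z in at z0. f z = F z" "F analytic_on {z0}"
  shows "remove_sings f analytic_on {z0}"
proof -
  have "\<forall>\<^sub>F z in at z0. remove_sings f z = F z"
    using eventually_at_imp_eventually_nhds[OF assms(1)]
      eventually_nhds_imp_at[OF analytic_at_eventually[OF assms(2)]]
    by eventually_elim (metis eventually_nhds_imp_at remove_sings_eventually_eq)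
  then have "\<forall>\<^sub>F z in nhds z0. remove_sings f z = F z"
    using remove_sings_eventually_eq[OF assms] by (simp add: eventually_nhds_conv_at)
  then show ?thesis
    using analytic_at_cong[OF _ refl] assms(2) by metis
qed

text \<open>\<open>J_rel\<close> and \<open>t3_neq_t1\<close> carry the information from the cusp,
  continued to all of \<open>uhp\<close>. With \<open>m1 \<ge> 2\<close>, the bound
  \<open>m2 \<ge> 3\<close> makes \<open>1 - 1/m1 - 1/m2\<close> nonzero.\<close>

locale halphen_hauptmodul =
  fixes m1 m2 :: nat and J t1 t2 t3 :: "complex \<Rightarrow> complex"
  assumes m1: "m1 \<ge> 2" and m2: "m2 \<ge> 3"
    and J_hol: "J holomorphic_on uhp" and J_nonconst: "\<not> J constant_on uhp"
    and halphen: "halphen_solution m1 m2 t1 t2 t3"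
    and J_rel: "\<tau> \<in> uhp \<Longrightarrow> \<forall>\<^sub>F z in at \<tau>. (t3 z - t1 z) * (1 - J z) = t2 z - t1 z"
    and t3_neq_t1: "\<tau> \<in> uhp \<Longrightarrow> \<forall>\<^sub>F z in at \<tau>. t3 z \<noteq> t1 z"
begin

section \<open>The Halphen system in terms of \<open>x\<close>, \<open>y\<close> and
  \<open>e2\<close>\<close>

definition p :: complex where "p = 1 / of_nat m1"
definition r :: complex where "r = 1 / of_nat m2"
definition x :: "complex \<Rightarrow> complex" where "x = (\<lambda>\<tau>. t1 \<tau> - t2 \<tau>)"
definition y :: "complex \<Rightarrow> complex" where "y = (\<lambda>\<tau>. t3 \<tau> - t2 \<tau>)"
text \<open>The multiple of \<open>E2\<close> by \<open>1 - 1 / m1 - 1 / m2\<close>.\<close>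
definition e2 :: "complex \<Rightarrow> complex" where
  "e2 = (\<lambda>\<tau>. - (1 + p + r) * t2 \<tau> - 2 * r * x \<tau> - 2 * p * y \<tau>)"
definition regular :: "complex \<Rightarrow> bool" where
  "regular \<tau> \<longleftrightarrow> \<tau> \<in> uhp \<and> t1 analytic_on {\<tau>} \<and> t2 analytic_on {\<tau>} \<and> t3 analytic_on {\<tau>}"

lemma eventually_regular:
  assumes "\<tau> \<in> uhp"
  shows "\<forall>\<^sub>F z in at \<tau>. regular z"
proof -
  have "\<forall>\<^sub>F z in at \<tau>. f analytic_on {z}" if "f meromorphic_on uhp" for f
    using meromorphic_on_imp_analytic_cosparse[OF that] assms
    by (rule eventually_cosparse_imp_eventually_at)
  moreover have "\<forall>\<^sub>F z in at \<tau>. z \<in> uhp"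
    using open_uhp assms by (rule eventually_at_in_open')
  ultimately show ?thesis
    using halphen unfolding regular_def halphen_solution_def
    by (intro eventually_conj) auto
qed

lemma J_analytic: "\<tau> \<in> uhp \<Longrightarrow> J analytic_on {\<tau>}"
  using J_hol open_uhp by (rule holomorphic_on_imp_analytic_at)

lemma eventually_J_neq:
  assumes "\<tau> \<in> uhp"
  shows "\<forall>\<^sub>F z in at \<tau>. J z \<noteq> c"
proof -
  obtain \<beta> where \<beta>: "\<beta> \<in> uhp" "J \<beta> - c \<noteq> 0"
    using J_nonconst unfolding constant_on_def by auto
  have "(\<lambda>z. J z - c) holomorphic_on uhp"
    by (intro holomorphic_intros J_hol)
  from non_zero_neighbour_alt[OF this open_uhp connected_uhp assms \<beta>] show ?thesis
    by eventually_elim simp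
qed

text \<open>Subtracting the equation for \<open>t2\<close> makes the right-hand sides for
  \<open>x\<close> and \<open>y\<close> divisible by \<open>x\<close> and \<open>y\<close>
  themselves. Their logarithmic derivatives are thus linear forms in \<open>t2\<close>,
  \<open>x\<close>, \<open>y\<close>.\<close>

lemma t2_has_D: "regular \<tau> \<Longrightarrow> has_D t2 (- (1 + p + r) / 2 * ((t2 \<tau>)\<^sup>2 - x \<tau> * y \<tau>)) \<tau>"
  and x_has_D: "regular \<tau> \<Longrightarrow>
      has_D x (x \<tau> * (- (1 + p + r) * t2 \<tau> - (1 + p) * y \<tau> - r * x \<tau>)) \<tau>"
  and y_has_D: "regular \<tau> \<Longrightarrow>
      has_D y (y \<tau> * (- (1 + p + r) * t2 \<tau> - (1 + r) * x \<tau> - p * y \<tau>)) \<tau>"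
proof -
  assume "regular \<tau>"
  then have
    D1: "has_D t1 ((hal_a m1 m2 - 1) * (t1 \<tau> * t2 \<tau> + t1 \<tau> * t3 \<tau> - t2 \<tau> * t3 \<tau>)
       + (hal_b m1 m2 + hal_c m1 m2 - 1) * (t1 \<tau>)\<^sup>2) \<tau>" and
    D2: "has_D t2 ((hal_b m1 m2 - 1) * (t2 \<tau> * t3 \<tau> + t2 \<tau> * t1 \<tau> - t1 \<tau> * t3 \<tau>)
       + (hal_a m1 m2 + hal_c m1 m2 - 1) * (t2 \<tau>)\<^sup>2) \<tau>" and
    D3: "has_D t3 ((hal_c m1 m2 - 1) * (t3 \<tau> * t1 \<tau> + t3 \<tau> * t2 \<tau> - t1 \<tau> * t2 \<tau>)
       + (hal_a m1 m2 + hal_b m1 m2 - 1) * (t3 \<tau>)\<^sup>2) \<tau>"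
    using halphen unfolding regular_def halphen_solution_def Let_def by blast+
  define a b where "a = hal_a m1 m2" and "b = hal_b m1 m2"
  \<comment> \<open>Since \<open>a + c = 1\<close> and the reciprocals of \<open>m1\<close> and
    \<open>m2\<close> are linear in \<open>a\<close> and \<open>b\<close>, each claim becomes a
    polynomial identity.\<close>
  have c: "hal_c m1 m2 = 1 - a" and p: "p = 1 - a - b" and r: "r = a - b"
    by (simp_all add: hal_a_def hal_b_def hal_c_def p_def r_def a_def b_def field_simps)
  have h: "- (1 + p + r) / 2 = b - 1"
    by (simp add: p r)
  have t: "t1 \<tau> = x \<tau> + t2 \<tau>" "t3 \<tau> = y \<tau> + t2 \<tau>"
    by (simp_all add: x_def y_def)
  note D = D1[folded a_def b_def, unfolded c t] D2[folded a_def b_def, unfolded c t]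
    D3[folded a_def b_def, unfolded c t]
  show "has_D t2 (- (1 + p + r) / 2 * ((t2 \<tau>)\<^sup>2 - x \<tau> * y \<tau>)) \<tau>"
    unfolding h by (rule has_D_eq[OF D(2)]) (simp add: power2_eq_square algebra_simps)
  show "has_D x (x \<tau> * (- (1 + p + r) * t2 \<tau> - (1 + p) * y \<tau> - r * x \<tau>)) \<tau>"
    by (rule has_D_eq[OF has_D_diff[OF D(1,2), folded x_def]])
      (simp add: p r power2_eq_square algebra_simps)
  show "has_D y (y \<tau> * (- (1 + p + r) * t2 \<tau> - (1 + r) * x \<tau> - p * y \<tau>)) \<tau>"
    by (rule has_D_eq[OF has_D_diff[OF D(3,2), folded y_def]])
      (simp add: p r power2_eq_square algebra_simps)
qed

text \<open>The coefficients of \<open>x\<close> and \<open>y\<close> in \<open>e2\<close> are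
  chosen so that half of \<open>e2^2\<close> absorbs every quadratic term except a multiple of
  \<open>x * y\<close>. That multiple comes from
  \<open>(1 + p + r)^2 - 4 * (p + r) = (1 - p - r)^2\<close>.\<close>

lemma e2_has_D:
  assumes "regular \<tau>"
  shows "has_D e2 (((e2 \<tau>)\<^sup>2 - (1 - p - r)\<^sup>2 * x \<tau> * y \<tau>) / 2) \<tau>"
proof -
  note * = has_D_diff[OF has_D_diff[OF has_D_const_mult has_D_const_mult] has_D_const_mult,
      OF t2_has_D x_has_D y_has_D, OF assms assms assms, of "- (1 + p + r)" "2 * r" "2 * p"]
  show ?thesis
    unfolding e2_def by (rule has_D_eq[OF *]) (simp add: power2_eq_square field_simps)
qed

text \<open>For the normalised derivative, \<open>x'/x = e2 + r * x + (p - 1) * y\<close> and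
  \<open>y'/y = e2 + (r - 1) * x + p * y\<close>; the monomial takes \<open>i\<close> times the
  first plus \<open>j\<close> times the second.\<close>

lemma monomial_has_D:
  assumes "regular \<tau>"
  shows "has_D (\<lambda>\<tau>. x \<tau> ^ i * y \<tau> ^ j) (of_nat (i + j) * e2 \<tau> * (x \<tau> ^ i * y \<tau> ^ j)
     + (of_nat (i + j) * r - of_nat j) * (x \<tau> ^ Suc i * y \<tau> ^ j)
     + (of_nat (i + j) * p - of_nat i) * (x \<tau> ^ i * y \<tau> ^ Suc j)) \<tau>"
proof -
  \<comment> \<open>The truncated exponent \<open>n - 1\<close> at \<open>n = 0\<close> is harmless
    because of the factor \<open>of_nat n\<close>.\<close>
  have Suc: "of_nat n * f ^ (n - 1) * (f * d) = of_nat n * f ^ n * d" for n and f d :: complex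
    by (cases n) simp_all
  show ?thesis
    by (rule has_D_eq[OF has_D_monomial[OF x_has_D[OF assms] y_has_D[OF assms]]])
      (unfold Suc, simp add: e2_def algebra_simps)
qed

abbreviation K :: complex where "K \<equiv> 1 - p - r"
abbreviation \<omega> :: complex where "\<omega> \<equiv> 2 * of_real pi * \<i>"

lemma K_nonzero: "K \<noteq> 0"
proof -
  have "1 / real m1 \<le> 1 / 2" "1 / real m2 \<le> 1 / 3"
    using m1 m2 by (auto intro!: divide_left_mono)
  then have "1 - 1 / real m1 - 1 / real m2 \<noteq> 0" by linarith
  moreover have "K = of_real (1 - 1 / real m1 - 1 / real m2)"
    by (simp add: p_def r_def)
  ultimately show ?thesis by (metis of_real_eq_0_iff)
qed

lemma eventually_regular_nhds: "regular z \<Longrightarrow> \<forall>\<^sub>F w in nhds z. regular w"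
  unfolding regular_def
  by (intro eventually_conj analytic_at_eventually eventually_nhds_in_open open_uhp) auto

lemma regular_analytic:
  assumes "regular z"
  shows "x analytic_on {z}" "y analytic_on {z}" "e2 analytic_on {z}"
  using assms unfolding regular_def x_def y_def e2_def by (auto intro!: analytic_intros)

section \<open>The hauptmodul and its logarithmic derivatives\<close>

lemma eventually_J_eq:
  assumes "\<tau> \<in> uhp"
  shows "\<forall>\<^sub>F z in at \<tau>. y z \<noteq> x z \<and> J z = y z / (y z - x z)"
  using J_rel[OF assms] t3_neq_t1[OF assms]
proof eventually_elim
  case (elim z)
  then have "y z - x z \<noteq> 0" "J z * (y z - x z) = y z"
    by (auto simp: x_def y_def algebra_simps)
  then show ?case by (auto simp: field_simps)
qed

text \<open>The quotient rule leaves \<open>x'/x - y'/y\<close>, which the Halphen system makes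
  equal to \<open>x - y\<close>; this cancels against the denominator \<open>y - x\<close>. The
  factor \<omega> converts to d/d\<tau>.\<close>

lemma eventually_deriv_J:
  assumes "\<tau> \<in> uhp"
  shows "\<forall>\<^sub>F z in at \<tau>. deriv J z = - \<omega> * x z * J z"
  using eventually_at_imp_eventually_nhds[OF eventually_J_eq[OF assms]] eventually_regular[OF assms]
proof eventually_elim
  case (elim z)
  have nz: "y z - x z \<noteq> 0" and Jz: "J z = y z / (y z - x z)"
    using eventually_nhds_x_imp_x[OF elim(1)] by auto
  define d where "d = x z * (- (1 + p + r) * t2 z - (1 + p) * y z - r * x z)"
  define e where "e = y z * (- (1 + p + r) * t2 z - (1 + r) * x z - p * y z)"
  have "\<forall>\<^sub>F w in nhds z. J w = y w / (y w - x w)"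
    using elim(1) by eventually_elim simp
  then have "deriv J z = deriv (\<lambda>w. y w / (y w - x w)) z"
    by (rule deriv_cong_ev) simp
  also have "\<dots> = (\<omega> * e * (y z - x z) - y z * (\<omega> * e - \<omega> * d)) / ((y z - x z) * (y z - x z))"
    using x_has_D[OF elim(2)] y_has_D[OF elim(2)] nz unfolding has_D_def d_def[symmetric] e_def[symmetric]
    by (intro DERIV_imp_deriv DERIV_divide DERIV_diff) auto
  also have "\<omega> * e * (y z - x z) - y z * (\<omega> * e - \<omega> * d) = - \<omega> * x z * y z * (y z - x z)"
    unfolding d_def e_def by (simp add: algebra_simps)
  finally show ?case
    using nz by (simp add: Jz)
qed

lemma eventually_logderiv_J:
  assumes "\<tau> \<in> uhp"
  shows "\<forall>\<^sub>F z in at \<tau>. deriv J z / J z = - \<omega> * x z \<and> deriv J z / (J z - 1) = - \<omega> * y z"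
  using eventually_deriv_J[OF assms] eventually_J_eq[OF assms]
    eventually_J_neq[OF assms, of 0] eventually_J_neq[OF assms, of 1]
proof eventually_elim
  case (elim z)
  have nz: "y z - x z \<noteq> 0" using elim(2) by simp
  have "J z - 1 = x z / (y z - x z)"
    using elim(2) nz by (simp add: field_simps)
  moreover from this have "x z \<noteq> 0" using elim(4) by auto
  ultimately show ?case
    using elim nz by simp
qed

text \<open>Differentiating \<open>J' = - \<omega> * x * J\<close> once more gives
  \<open>J''/J' = \<omega> * (d - x)\<close>, where \<open>d\<close> is the normalised
  \<open>x'/x\<close>. The multiples of \<open>J'/J\<close> and \<open>J'/(J - 1)\<close> then
  adjust the coefficients of \<open>x\<close> and \<open>y\<close> to those in
  \<open>e2\<close>.\<close>

lemma eventually_e2_eq: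
  assumes "\<tau> \<in> uhp"
  shows "\<forall>\<^sub>F z in at \<tau>. \<omega> * e2 z = deriv (deriv J) z / deriv J z
      - (1 - 1 / of_nat m2) * (deriv J z / J z) - (1 - 1 / of_nat m1) * (deriv J z / (J z - 1))"
  using eventually_at_imp_eventually_nhds[OF eventually_deriv_J[OF assms]]
    eventually_regular[OF assms] eventually_logderiv_J[OF assms] eventually_J_eq[OF assms]
    eventually_J_neq[OF assms, of 0] eventually_J_neq[OF assms, of 1]
proof eventually_elim
  case (elim z)
  define d where "d = - (1 + p + r) * t2 z - (1 + p) * y z - r * x z"
  have J': "deriv J z = - \<omega> * x z * J z"
    using eventually_nhds_x_imp_x[OF elim(1)] .
  have Jz: "(J has_field_derivative - \<omega> * x z * J z) (at z)"
    using analytic_derivI[OF J_analytic, of z] elim(2) J' by (simp add: regular_def)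
  have dx: "(x has_field_derivative \<omega> * (x z * d)) (at z)"
    using x_has_D[OF elim(2)] by (simp add: has_D_def d_def)
  have xz: "x z \<noteq> 0" using elim(4,6) by auto
  have "deriv (deriv J) z = deriv (\<lambda>w. - \<omega> * (x w * J w)) z"
    using elim(1) by (intro deriv_cong_ev) (auto simp: mult.assoc)
  also have "\<dots> = - \<omega> * (\<omega> * (x z * d) * J z + - \<omega> * x z * J z * x z)"
    by (intro DERIV_imp_deriv DERIV_cmult DERIV_mult dx Jz)
  also have "\<dots> = deriv J z * (\<omega> * (d - x z))"
    unfolding J' by (simp add: algebra_simps)
  finally have "deriv (deriv J) z / deriv J z = \<omega> * (d - x z)"
    using J' xz elim(5) by simp
  then show ?case
    using elim(3) by (simp add: d_def e2_def p_def r_def algebra_simps)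
qed

text \<open>This is the form required by the local analysis: the derivative is d/d\<tau>, its
  constant is \<open>K\<^sup>2\<close>, and the signs of \<open>- \<omega> * x\<close> and
  \<open>- \<omega> * y\<close> cancel in the product.\<close>

lemma eventually_e2_riccati:
  assumes "\<tau> \<in> uhp"
  shows "\<forall>\<^sub>F z in at \<tau>. ((\<lambda>z. \<omega> * e2 z) has_field_derivative
      ((\<omega> * e2 z)\<^sup>2 - K\<^sup>2 * (deriv J z / J z) * (deriv J z / (J z - 1))) / 2) (at z)"
  using eventually_regular[OF assms] eventually_logderiv_J[OF assms]
proof eventually_elim
  case (elim z)
  have scale: "w * (w * ((e\<^sup>2 - k * a * b) / 2)) = ((w * e)\<^sup>2 - k * (- w * a) * (- w * b)) / 2"
    for w e k a b :: complex
    by (simp add: power2_eq_square algebra_simps)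
  have "((\<lambda>z. \<omega> * e2 z) has_field_derivative \<omega> * (\<omega> * (((e2 z)\<^sup>2 - K\<^sup>2 * x z * y z) / 2))) (at z)"
    using e2_has_D[OF elim(1)] unfolding has_D_def by (rule DERIV_cmult)
  moreover have "\<omega> * (\<omega> * (((e2 z)\<^sup>2 - K\<^sup>2 * x z * y z) / 2))
      = ((\<omega> * e2 z)\<^sup>2 - K\<^sup>2 * (- \<omega> * x z) * (- \<omega> * y z)) / 2"
    by (rule scale)
  ultimately show ?case
    unfolding conjunct1[OF elim(2)] conjunct2[OF elim(2)] by (rule DERIV_cong)
qed

section \<open>Holomorphy of the Eisenstein series\<close>

lemma
  assumes "\<tau> \<in> uhp"
  shows e2_regular: "\<exists>H. H analytic_on {\<tau>} \<and> (\<forall>\<^sub>F z in at \<tau>. e2 z = H z)"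
    and xy_regular: "i \<le> j * (m2 - 1) \<Longrightarrow> j \<le> i * (m1 - 1) \<Longrightarrow>
      \<exists>H. H analytic_on {\<tau>} \<and> (\<forall>\<^sub>F z in at \<tau>. x z ^ i * y z ^ j = H z)"
proof -
  have "m1 > 0" "m2 > 0" using m1 m2 by auto
  note * = J_analytic[OF assms] eventually_J_neq[OF assms] this
    eventually_e2_eq[OF assms] eventually_e2_riccati[OF assms]
  have \<omega>: "\<omega> \<noteq> 0" by simp
  obtain H where H: "H analytic_on {\<tau>}" "\<forall>\<^sub>F z in at \<tau>. \<omega> * e2 z = H z"
    using riccati_regular[OF *] by blast
  show "\<exists>H. H analytic_on {\<tau>} \<and> (\<forall>\<^sub>F z in at \<tau>. e2 z = H z)"
  proof (intro exI conjI)
    show "(\<lambda>z. H z / \<omega>) analytic_on {\<tau>}"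
      using \<omega> by (intro analytic_intros H)
    show "\<forall>\<^sub>F z in at \<tau>. e2 z = H z / \<omega>"
      using H(2) by eventually_elim (use \<omega> in \<open>simp add: field_simps\<close>)
  qed
  assume ij: "i \<le> j * (m2 - 1)" "j \<le> i * (m1 - 1)"
  obtain H where H: "H analytic_on {\<tau>}"
    "\<forall>\<^sub>F z in at \<tau>. (deriv J z / J z) ^ i * (deriv J z / (J z - 1)) ^ j = H z"
    using monomial_regular[OF * ij] by blast
  show "\<exists>H. H analytic_on {\<tau>} \<and> (\<forall>\<^sub>F z in at \<tau>. x z ^ i * y z ^ j = H z)"
  proof (intro exI conjI)
    show "(\<lambda>z. H z / (- \<omega>) ^ (i + j)) analytic_on {\<tau>}"
      using \<omega> by (intro analytic_intros H) auto
    show "\<forall>\<^sub>F z in at \<tau>. x z ^ i * y z ^ j = H z / (- \<omega>) ^ (i + j)"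
      using H(2) eventually_logderiv_J[OF assms]
    proof eventually_elim
      case (elim z)
      have "H z = (- \<omega>) ^ (i + j) * (x z ^ i * y z ^ j)"
        using elim(1) conjunct1[OF elim(2)] conjunct2[OF elim(2)]
        by (simp only: power_mult_distrib power_add mult_ac)
      moreover have "(- \<omega>) ^ (i + j) \<noteq> 0" using \<omega> by simp
      ultimately show ?case by (metis nonzero_mult_div_cancel_left)
    qed
  qed
qed

text \<open>The common shape of the series of weight at least 4: \<open>M 1 1\<close> is
  \<open>E4\<close>, and the two families are \<open>M 1 (k - 1)\<close> and
  \<open>M (k - 1) 1\<close>.\<close>

definition M :: "nat \<Rightarrow> nat \<Rightarrow> complex \<Rightarrow> complex" where
  "M i j = remove_sings (\<lambda>\<tau>. x \<tau> ^ i * y \<tau> ^ j)"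
definition E2 :: "complex \<Rightarrow> complex" where
  "E2 = remove_sings (\<lambda>\<tau>. e2 \<tau> / K)"

lemma M_analytic:
  assumes "\<tau> \<in> uhp" "i \<le> j * (m2 - 1)" "j \<le> i * (m1 - 1)"
  shows "M i j analytic_on {\<tau>}"
proof -
  obtain H where "H analytic_on {\<tau>}" "\<forall>\<^sub>F z in at \<tau>. x z ^ i * y z ^ j = H z"
    using xy_regular[OF assms] by blast
  from remove_sings_eventually_analytic[OF this(2,1)] show ?thesis
    unfolding M_def .
qed

lemma E2_analytic:
  assumes "\<tau> \<in> uhp"
  shows "E2 analytic_on {\<tau>}"
proof -
  obtain H where H: "H analytic_on {\<tau>}" "\<forall>\<^sub>F z in at \<tau>. e2 z = H z"
    using e2_regular[OF assms] by blast
  have "\<forall>\<^sub>F z in at \<tau>. e2 z / K = H z / K"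
    using H(2) by eventually_elim simp
  moreover have "(\<lambda>z. H z / K) analytic_on {\<tau>}"
    using K_nonzero by (intro analytic_intros H)
  ultimately show ?thesis
    unfolding E2_def by (rule remove_sings_eventually_analytic)
qed

section \<open>The differential equations, first at regular points, then on all of
  \<open>uhp\<close>\<close>

lemma M_regular: "regular z \<Longrightarrow> M i j z = x z ^ i * y z ^ j"
  unfolding M_def by (rule remove_sings_at_analytic) (intro analytic_intros regular_analytic)

lemma E2_regular: "regular z \<Longrightarrow> E2 z = e2 z / K"
  unfolding E2_def using K_nonzero
  by (intro remove_sings_at_analytic analytic_intros regular_analytic)

lemma M_has_D:
  assumes "regular z"
  shows "has_D (M i j) (of_nat (i + j) * (K * E2 z) * M i j z
     + (of_nat (i + j) * r - of_nat j) * (x z ^ Suc i * y z ^ j)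
     + (of_nat (i + j) * p - of_nat i) * (x z ^ i * y z ^ Suc j)) z"
proof -
  have "\<forall>\<^sub>F w in nhds z. M i j w = x w ^ i * y w ^ j"
    using eventually_regular_nhds[OF assms] by eventually_elim (rule M_regular)
  from has_D_cong[OF this] monomial_has_D[OF assms, of i j] show ?thesis
    using K_nonzero by (simp add: M_regular[OF assms] E2_regular[OF assms])
qed

lemma E2_has_D:
  assumes "regular z"
  shows "has_D E2 (K / 2 * ((E2 z)\<^sup>2 - M 1 1 z)) z"
proof -
  have scale: "1 / k * ((e\<^sup>2 - k\<^sup>2 * a * b) / 2) = k / 2 * ((e / k)\<^sup>2 - a * b)" if "k \<noteq> 0"
    for e k a b :: complex
    using that by (simp add: power2_eq_square field_simps)
  have "\<forall>\<^sub>F w in nhds z. E2 w = 1 / K * e2 w"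
    using eventually_regular_nhds[OF assms] by eventually_elim (simp add: E2_regular)
  moreover have "1 / K * (((e2 z)\<^sup>2 - K\<^sup>2 * x z * y z) / 2) = K / 2 * ((E2 z)\<^sup>2 - M 1 1 z)"
    unfolding M_regular[OF assms] E2_regular[OF assms] power_one_right
    using K_nonzero by (rule scale)
  ultimately show ?thesis
    using has_D_cong has_D_const_mult[OF e2_has_D[OF assms], of "1 / K"] by metis
qed

lemma E2_identity: "\<tau> \<in> uhp \<Longrightarrow> has_D E2 (K / 2 * ((E2 \<tau>)\<^sup>2 - M 1 1 \<tau>)) \<tau>"
  using m1 m2 eventually_mono[OF eventually_regular E2_has_D]
  by (intro has_D_extend[where G = "\<lambda>\<tau>. K / 2 * ((E2 \<tau>)\<^sup>2 - M 1 1 \<tau>)"]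
      analytic_intros E2_analytic M_analytic) auto

text \<open>\<open>A\<close> and \<open>B\<close> stand for the terms with the two neighbouring
  monomials. They are left abstract because such a term may be written as a product of two series,
  or be a monomial with a pole multiplied by \<open>0\<close>.\<close>

lemma M_identity:
  assumes \<tau>: "\<tau> \<in> uhp" and ij: "i \<le> j * (m2 - 1)" "j \<le> i * (m1 - 1)"
    and A: "A analytic_on {\<tau>}"
      "\<And>z. regular z \<Longrightarrow> A z = (of_nat (i + j) * r - of_nat j) * (x z ^ Suc i * y z ^ j)"
    and B: "B analytic_on {\<tau>}"
      "\<And>z. regular z \<Longrightarrow> B z = (of_nat (i + j) * p - of_nat i) * (x z ^ i * y z ^ Suc j)"
  shows "has_D (M i j) (of_nat (i + j) * (K * E2 \<tau>) * M i j \<tau> + A \<tau> + B \<tau>) \<tau>"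
proof (rule has_D_extend[where G = "\<lambda>\<tau>. of_nat (i + j) * (K * E2 \<tau>) * M i j \<tau> + A \<tau> + B \<tau>"])
  show "M i j analytic_on {\<tau>}" by (rule M_analytic[OF \<tau> ij])
  show "(\<lambda>\<tau>. of_nat (i + j) * (K * E2 \<tau>) * M i j \<tau> + A \<tau> + B \<tau>) analytic_on {\<tau>}"
    by (intro analytic_intros E2_analytic M_analytic \<tau> ij A B)
  show "\<forall>\<^sub>F z in at \<tau>. has_D (M i j) (of_nat (i + j) * (K * E2 z) * M i j z + A z + B z) z"
    using eventually_regular[OF \<tau>] by eventually_elim (simp only: A(2) B(2) M_has_D)
qed

text \<open>In the top weight the next monomial has a pole at an elliptic point, but coefficient \<open>0\<close>.\<close>
lemma M_analytic_unless_zero: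
  assumes "c \<noteq> 0 \<Longrightarrow> M i j analytic_on {\<tau>}"
  shows "(\<lambda>z. c * M i j z) analytic_on {\<tau>}"
  using assms by (cases "c = 0") (auto intro!: analytic_intros)

end

section \<open>Behaviour at the cusp\<close>

lemma at_i_infD:
  assumes "\<forall>\<^sub>F \<tau> in at_i_inf. P \<tau>"
  obtains B where "B \<ge> 0" "\<And>\<tau>. Im \<tau> > B \<Longrightarrow> P \<tau>"
proof -
  obtain Q where Q: "eventually Q (at_top :: real filter)" "\<And>\<tau>. Q (Im \<tau>) \<Longrightarrow> P \<tau>"
    using assms unfolding at_i_inf_def eventually_filtercomap by blast
  obtain B where B: "\<And>t. t \<ge> B \<Longrightarrow> Q t"
    using Q(1) unfolding eventually_at_top_linorder by blast
  \<comment> \<open>The maximum with \<open>0\<close> keeps the half-plane above \<open>B\<close>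
    inside \<open>uhp\<close>.\<close>
  show ?thesis
    by (rule that[of "max B 0"]) (auto intro!: Q(2) B)
qed

text \<open>Identity theorem: on a connected open set, a meromorphic function equals
  \<open>c\<close> off a sparse set or differs from \<open>c\<close> off a sparse set.\<close>

lemma meromorphic_zero_or_nonzero:
  assumes "f meromorphic_on A" "open A" "connected A" "\<tau>0 \<in> A" "\<forall>\<^sub>F z in at \<tau>0. f z = c" "\<tau> \<in> A"
  shows "\<forall>\<^sub>F z in at \<tau>. f z = c"
  using meromorphic_imp_constant_or_avoid[OF assms(1-3), of c]
proof
  assume "\<forall>\<^sub>\<approx>z\<in>A. f z = c"
  then show ?thesis
    using assms(6) by (rule eventually_cosparse_imp_eventually_at)
next
  assume "\<forall>\<^sub>\<approx>z\<in>A. f z \<noteq> c"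
  then have "\<forall>\<^sub>F z in at \<tau>0. f z \<noteq> c"
    using assms(4) by (rule eventually_cosparse_imp_eventually_at)
  with assms(5) have "\<forall>\<^sub>F z in at \<tau>0. False"
    by eventually_elim simp
  then show ?thesis by simp
qed

text \<open>Along the imaginary axis \<open>q\<close> tends to \<open>0\<close>, whereas a function
  equal to \<open>-1\<close> has norm \<open>1\<close>. This serves to refute \<open>E2 = 0\<close>
  near the cusp.\<close>

lemma not_bigo_exp_at_i_inf:
  assumes "f \<in> O[at_i_inf](\<lambda>\<tau>. exp (2 * of_real pi * \<i> * \<tau>))"
  shows "\<not> (\<forall>\<^sub>F \<tau> in at_i_inf. f \<tau> = -1)"
proof
  assume "\<forall>\<^sub>F \<tau> in at_i_inf. f \<tau> = -1"
  moreover obtain C where "\<forall>\<^sub>F \<tau> in at_i_inf. norm (f \<tau>) \<le> C * norm (exp (2 * of_real pi * \<i> * \<tau>))"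
    using assms by (elim landau_o.bigE)
  ultimately have "\<forall>\<^sub>F \<tau> in at_i_inf. 1 \<le> C * exp (- 2 * pi * Im \<tau>)"
    by eventually_elim (simp add: norm_exp_eq_Re)
  then obtain B where "\<And>\<tau>. Im \<tau> > B \<Longrightarrow> 1 \<le> C * exp (- 2 * pi * Im \<tau>)"
    by (rule at_i_infD) blast
  from this[of "\<i> * of_real t" for t] have "1 \<le> C * exp (- 2 * pi * t)" if "t > B" for t
    using that by simp
  then have "\<forall>\<^sub>F t in at_top. 1 \<le> C * exp (- 2 * pi * t)"
    using eventually_gt_at_top[of B] by (rule eventually_mono[rotated])
  moreover have "((\<lambda>t. C * exp (- 2 * pi * t)) \<longlongrightarrow> 0) at_top"
    by real_asymp
  ultimately show False
    using tendsto_lowerbound[of _ 0 at_top 1] by fastforce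
qed

text \<open>At the cusp \<open>t3 - t1\<close> is \<open>z\<close> times \<open>t2 - t1\<close>;
  this ratio involves neither the power nor the hypergeometric function. The resulting relation is
  between meromorphic functions, so it continues from a half-plane to \<open>uhp\<close>.\<close>

lemma hauptmodul_relation:
  assumes J: "standard_hauptmodul m1 m2 u J"
    and hal: "halphen_solution m1 m2 t1 t2 t3"
    and hyp: "hypergeometric_at_cusp m1 m2 J \<kappa> t1 t2 t3"
    and \<tau>: "\<tau> \<in> uhp"
  shows "\<forall>\<^sub>F z in at \<tau>. (t3 z - t1 z) * (1 - J z) = t2 z - t1 z"
proof -
  \<comment> \<open>This makes \<open>z\<close> a true reciprocal of \<open>1 - J\<close> instead of
    the default value of \<open>1 / 0\<close>.\<close>
  have "\<forall>\<^sub>F \<tau> in at_i_inf. J \<tau> \<noteq> 1"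
    using J unfolding standard_hauptmodul_def by (auto intro: filterlim_at_infinity_imp_eventually_ne)
  with hyp have "\<forall>\<^sub>F \<tau> in at_i_inf. (t3 \<tau> - t1 \<tau>) * (1 - J \<tau>) = t2 \<tau> - t1 \<tau>"
    unfolding hypergeometric_at_cusp_def Let_def by eventually_elim (auto simp: field_simps)
  then obtain B where B: "B \<ge> 0" "\<And>\<tau>. Im \<tau> > B \<Longrightarrow> (t3 \<tau> - t1 \<tau>) * (1 - J \<tau>) = t2 \<tau> - t1 \<tau>"
    by (rule at_i_infD) blast
  define \<tau>0 where "\<tau>0 = \<i> * of_real (B + 1)"
  have \<tau>0: "\<tau>0 \<in> uhp" "Im \<tau>0 > B" using B(1) by (auto simp: \<tau>0_def uhp_def)
  have "\<forall>\<^sub>F z in at \<tau>0. (t3 z - t1 z) * (1 - J z) - (t2 z - t1 z) = 0"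
    using eventually_at_in_open'[OF open_halfspace_Im_gt, of \<tau>0 B] \<tau>0(2)
    by (auto elim!: eventually_mono simp: B(2))
  moreover have "J meromorphic_on uhp"
    using J by (simp add: standard_hauptmodul_def analytic_on_imp_meromorphic_on analytic_on_open open_uhp)
  then have "(\<lambda>z. (t3 z - t1 z) * (1 - J z) - (t2 z - t1 z)) meromorphic_on uhp"
    using hal unfolding halphen_solution_def by (intro meromorphic_intros) auto
  ultimately have "\<forall>\<^sub>F z in at \<tau>. (t3 z - t1 z) * (1 - J z) - (t2 z - t1 z) = 0"
    using meromorphic_zero_or_nonzero open_uhp connected_uhp \<tau>0(1) \<tau> by blast
  then show ?thesis by eventually_elim simp
qed

text \<open>Otherwise \<open>t3 = t1\<close> throughout \<open>uhp\<close> up to a sparse set, the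
  cusp formulas force all three functions to vanish near the cusp, and \<open>E2 = 0\<close> there
  contradicts its normalisation.\<close>

lemma halphen_nondegenerate:
  assumes J: "standard_hauptmodul m1 m2 u J"
    and hal: "halphen_solution m1 m2 t1 t2 t3"
    and hyp: "hypergeometric_at_cusp m1 m2 J \<kappa> t1 t2 t3"
    and E2: "(\<lambda>\<tau>. eis_E2 m1 m2 t1 t2 t3 \<tau> - 1) \<in> O[at_i_inf](\<lambda>\<tau>. exp (2 * of_real pi * \<i> * \<tau>))"
    and \<tau>: "\<tau> \<in> uhp"
  shows "\<forall>\<^sub>F z in at \<tau>. t3 z \<noteq> t1 z"
proof (rule ccontr)
  assume contra: "\<not> (\<forall>\<^sub>F z in at \<tau>. t3 z \<noteq> t1 z)"
  have mero: "(\<lambda>z. t3 z - t1 z) meromorphic_on uhp"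
    using hal unfolding halphen_solution_def by (auto intro!: meromorphic_intros)
  have "\<forall>\<^sub>\<approx>z\<in>uhp. t3 z - t1 z = 0"
    using meromorphic_imp_constant_or_avoid[OF mero open_uhp connected_uhp, of 0]
      eventually_cosparse_imp_eventually_at[OF _ \<tau>] contra by (auto elim: eventually_mono)
  then have eq: "\<forall>\<^sub>F z in at \<tau>. t3 z - t1 z = 0" if "\<tau> \<in> uhp" for \<tau>
    using that by (rule eventually_cosparse_imp_eventually_at)
  have "\<forall>\<^sub>F \<tau> in at_i_inf. J \<tau> \<noteq> 1"
    using J unfolding standard_hauptmodul_def by (auto intro: filterlim_at_infinity_imp_eventually_ne)
  \<comment> \<open>As \<open>z\<close> is nonzero, \<open>t3 = t1\<close> forces \<kappa>, the
    power or \<open>F\<close> to vanish. Each of these is also a factor of \<open>t2 - t1\<close>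
    and of \<open>t1\<close>.\<close>
  with hyp have "\<forall>\<^sub>F \<tau> in at_i_inf. t3 \<tau> = t1 \<tau> \<longrightarrow> t1 \<tau> = 0 \<and> t2 \<tau> = 0"
    unfolding hypergeometric_at_cusp_def Let_def by eventually_elim auto
  then obtain B where B: "B \<ge> 0" "\<And>\<tau>. Im \<tau> > B \<Longrightarrow> t3 \<tau> = t1 \<tau> \<longrightarrow> t1 \<tau> = 0 \<and> t2 \<tau> = 0"
    by (rule at_i_infD) blast
  have "eis_E2 m1 m2 t1 t2 t3 \<tau> = 0" if "Im \<tau> > B" for \<tau>
    unfolding eis_E2_def
  proof (rule remove_sings_eventually_eq)
    have "\<tau> \<in> uhp" using that B(1) by (simp add: uhp_def)
    note eq = eq[OF this]
    have "\<forall>\<^sub>F z in at \<tau>. z \<in> {z. Im z > B}"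
      using open_halfspace_Im_gt that by (intro eventually_at_in_open') auto
    with eq show "\<forall>\<^sub>F \<tau> in at \<tau>. 1 / (of_nat m1 + of_nat m2 - of_nat m1 * of_nat m2) *
       (2 * of_nat m1 * (t1 \<tau> - t2 \<tau>) + 2 * of_nat m2 * (t3 \<tau> - t2 \<tau>) +
        (of_nat m1 + of_nat m2 + of_nat m1 * of_nat m2) * t2 \<tau>) = 0"
    proof eventually_elim
      case (elim z)
      then have "t1 z = 0" "t2 z = 0" "t3 z = 0" using B(2)[of z] by auto
      then show ?case by simp
    qed
  qed simp
  then have "\<forall>\<^sub>F \<tau> in at_i_inf. eis_E2 m1 m2 t1 t2 t3 \<tau> - 1 = -1"
    unfolding at_i_inf_def eventually_filtercomap
    by (intro exI[of _ "\<lambda>t. t > B"]) (auto simp: eventually_gt_at_top)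
  then show False
    using not_bigo_exp_at_i_inf[OF E2] by simp
qed

section \<open>The identities for the Eisenstein series\<close>

theorem lemma2p5:
  fixes m1 m2 :: nat and u :: real and \<kappa> :: complex
    and J t1 t2 t3 :: "complex \<Rightarrow> complex"
  assumes "2 \<le> m1" and "m1 \<le> m2" and "(m1, m2) \<noteq> (2, 2)"
    and "standard_hauptmodul m1 m2 u J"
    and "halphen_solution m1 m2 t1 t2 t3"
    and "hypergeometric_at_cusp m1 m2 J \<kappa> t1 t2 t3"
    and "(\<lambda>\<tau>. eis_E2 m1 m2 t1 t2 t3 \<tau> - 1) \<in> O[at_i_inf](\<lambda>\<tau>. exp (2 * of_real pi * \<i> * \<tau>))"
  shows
    "(\<forall>\<tau>\<in>uhp. has_D (eis_E2 m1 m2 t1 t2 t3)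
       ((of_nat m1 * of_nat m2 - of_nat m1 - of_nat m2) / (2 * of_nat m1 * of_nat m2) *
          ((eis_E2 m1 m2 t1 t2 t3 \<tau>)\<^sup>2 - eis_E4 t1 t2 t3 \<tau>)) \<tau>)
     \<and> (\<forall>\<tau>\<in>uhp. has_D (eis_E4 t1 t2 t3)
       (2 * ((of_nat m1 * of_nat m2 - of_nat m1 - of_nat m2) / (of_nat m1 * of_nat m2)) *
          eis_E2 m1 m2 t1 t2 t3 \<tau> * eis_E4 t1 t2 t3 \<tau>
        - (of_nat m1 - 2) / of_nat m1 * eis1 t1 t2 t3 3 \<tau>
        - (of_nat m2 - 2) / of_nat m2 * eis2 t1 t2 t3 3 \<tau>) \<tau>)
     \<and> (\<forall>k::nat. 2 < k \<and> k \<le> m1 \<longrightarrow> (\<forall>\<tau>\<in>uhp. has_D (eis1 t1 t2 t3 k)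
       (of_nat k * (of_nat m1 * of_nat m2 - of_nat m1 - of_nat m2) / (of_nat m1 * of_nat m2) *
          eis_E2 m1 m2 t1 t2 t3 \<tau> * eis1 t1 t2 t3 k \<tau>
        - (of_nat k * of_nat m2 - of_nat k - of_nat m2) / of_nat m2 *
          eis_E4 t1 t2 t3 \<tau> * eis1 t1 t2 t3 (k - 1) \<tau>
        - (of_nat m1 - of_nat k) / of_nat m1 * eis1 t1 t2 t3 (k + 1) \<tau>) \<tau>))
     \<and> (\<forall>k::nat. 2 < k \<and> k \<le> m2 \<longrightarrow> (\<forall>\<tau>\<in>uhp. has_D (eis2 t1 t2 t3 k)
       (of_nat k * (of_nat m1 * of_nat m2 - of_nat m1 - of_nat m2) / (of_nat m1 * of_nat m2) *
          eis_E2 m1 m2 t1 t2 t3 \<tau> * eis2 t1 t2 t3 k \<tau>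
        - (of_nat k * of_nat m1 - of_nat k - of_nat m1) / of_nat m1 *
          eis_E4 t1 t2 t3 \<tau> * eis2 t1 t2 t3 (k - 1) \<tau>
        - (of_nat m2 - of_nat k) / of_nat m2 * eis2 t1 t2 t3 (k + 1) \<tau>) \<tau>))"
proof -
  have m: "m1 \<ge> 2" "m2 \<ge> 3" using assms(1-3) by auto
  have J: "J holomorphic_on uhp" "J ` uhp = UNIV"
    using assms(4) by (auto simp: standard_hauptmodul_def)
  have "\<not> J constant_on uhp"
  proof
    assume "J constant_on uhp"
    then obtain c where "J ` uhp \<subseteq> {c}" by (auto simp: constant_on_def)
    then have "UNIV \<subseteq> {c}" using J(2) by simp
    then have "c + 1 = c" by blast
    then show False by simp
  qed
  then interpret halphen_hauptmodul m1 m2 J t1 t2 t3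
    using m J(1) assms(5) hauptmodul_relation[OF assms(4-6)] halphen_nondegenerate[OF assms(4-7)]
    by unfold_locales auto
  have m0: "of_nat m1 \<noteq> (0 :: complex)" "of_nat m2 \<noteq> (0 :: complex)" using m by auto
  have K: "(of_nat m1 * of_nat m2 - of_nat m1 - of_nat m2) / (of_nat m1 * of_nat m2) = K"
    using m0 by (simp add: p_def r_def field_simps)
  have pk: "(of_nat m1 - of_nat k) / of_nat m1 = 1 - of_nat k * p"
    and rk: "(of_nat m2 - of_nat k) / of_nat m2 = 1 - of_nat k * r" for k
    using m0 by (simp_all add: p_def r_def diff_divide_distrib)
  have rk': "(of_nat k * of_nat m2 - of_nat k - of_nat m2) / of_nat m2 = of_nat k - 1 - of_nat k * r"
    and pk': "(of_nat k * of_nat m1 - of_nat k - of_nat m1) / of_nat m1 = of_nat k - 1 - of_nat k * p" for k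
    using m0 by (simp_all add: p_def r_def diff_divide_distrib)
  have pk2: "(of_nat m1 - 2) / of_nat m1 = 1 - 2 * p" and rk2: "(of_nat m2 - 2) / of_nat m2 = 1 - 2 * r"
    using pk[of 2] rk[of 2] by simp_all
  have E2_eq: "eis_E2 m1 m2 t1 t2 t3 = E2"
  proof -
    \<comment> \<open>The prefactor has denominator \<open>- m1 * m2 * K\<close> and the bracket
      equals \<open>- m1 * m2 * e2\<close>, so the signs cancel.\<close>
    have s: "of_nat m1 + of_nat m2 - of_nat m1 * of_nat m2 = - (of_nat m1 * of_nat m2) * K"
      using m0 by (simp add: p_def r_def field_simps)
    have "1 / (of_nat m1 + of_nat m2 - of_nat m1 * of_nat m2) *
       (2 * of_nat m1 * x \<tau> + 2 * of_nat m2 * y \<tau> +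
        (of_nat m1 + of_nat m2 + of_nat m1 * of_nat m2) * t2 \<tau>) = e2 \<tau> / K" for \<tau>
    proof -
      have "2 * of_nat m1 * x \<tau> + 2 * of_nat m2 * y \<tau> +
        (of_nat m1 + of_nat m2 + of_nat m1 * of_nat m2) * t2 \<tau> = - (of_nat m1 * of_nat m2) * e2 \<tau>"
        using m0 by (simp add: e2_def p_def r_def field_simps)
      then show ?thesis
        unfolding s using m0 K_nonzero by simp
    qed
    then show ?thesis
      by (simp add: eis_E2_def E2_def x_def y_def)
  qed
  have E4_eq: "eis_E4 t1 t2 t3 = M 1 1"
    by (simp add: eis_E4_def M_def x_def y_def)
  have eis1_eq: "eis1 t1 t2 t3 k = M 1 (k - 1)" and eis2_eq: "eis2 t1 t2 t3 k = M (k - 1) 1" for k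
    by (simp_all add: eis1_def eis2_def M_def x_def y_def)
  note rew = E2_eq E4_eq eis1_eq eis2_eq
  \<comment> \<open>Since \<open>eis1 t1 t2 t3 k\<close> is \<open>M 1 (k - 1)\<close>, the range
    \<open>2 \<le> k \<le> m1\<close> becomes \<open>1 \<le> j < m1\<close>; likewise for the second
    family.\<close>
  have an1: "M 1 j analytic_on {\<tau>}" if "\<tau> \<in> uhp" "1 \<le> j" "j < m1" for j \<tau>
    using that m by (intro M_analytic) (auto intro: order_trans[of _ "m2 - 1"])
  have an2: "M i 1 analytic_on {\<tau>}" if "\<tau> \<in> uhp" "1 \<le> i" "i < m2" for i \<tau>
    using that m by (intro M_analytic) (auto intro: order_trans[of _ "m1 - 1"])
  have 1: "has_D E2 (K / 2 * ((E2 \<tau>)\<^sup>2 - M 1 1 \<tau>)) \<tau>" if "\<tau> \<in> uhp" for \<tau>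
    using that by (rule E2_identity)
  have 2: "has_D (M 1 1) (2 * K * E2 \<tau> * M 1 1 \<tau> - (1 - 2 * p) * M 1 2 \<tau> - (1 - 2 * r) * M 2 1 \<tau>) \<tau>"
    if \<tau>: "\<tau> \<in> uhp" for \<tau>
  proof -
    \<comment> \<open>For \<open>m1 = 2\<close> the monomial \<open>M 1 2\<close> is outside the
      range of \<open>an1\<close>, but its coefficient \<open>2 * p - 1\<close> is then
      \<open>0\<close>. \<open>M 2 1\<close> is always in range because
      \<open>m2 \<ge> 3\<close>.\<close>
    have "2 * p - 1 \<noteq> 0 \<Longrightarrow> m1 \<noteq> 2" by (auto simp: p_def)
    then have B: "(\<lambda>z. (2 * p - 1) * M 1 2 z) analytic_on {\<tau>}"
      using m \<tau> by (intro M_analytic_unless_zero an1) auto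
    have A: "(\<lambda>z. (2 * r - 1) * M 2 1 z) analytic_on {\<tau>}"
      using m \<tau> by (intro analytic_intros an2) auto
    have "has_D (M 1 1) (of_nat (1 + 1) * (K * E2 \<tau>) * M 1 1 \<tau> + (2 * r - 1) * M 2 1 \<tau> + (2 * p - 1) * M 1 2 \<tau>) \<tau>"
      using m by (intro M_identity \<tau> A B) (simp_all add: M_regular power2_eq_square)
    then show ?thesis
      by (rule has_D_eq) (simp add: algebra_simps)
  qed
  have 3: "has_D (M 1 (k - 1)) (of_nat k * K * E2 \<tau> * M 1 (k - 1) \<tau>
      - (of_nat k - 1 - of_nat k * r) * M 1 1 \<tau> * M 1 (k - 2) \<tau> - (1 - of_nat k * p) * M 1 k \<tau>) \<tau>"
    if k: "2 < k" "k \<le> m1" and \<tau>: "\<tau> \<in> uhp" for k \<tau>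
  proof -
    have Suc: "Suc (k - 1) = k" and pow: "a ^ (k - 1) = a * a ^ (k - 2)" and of: "of_nat (1 + (k - 1)) = (of_nat k :: complex)"
      "of_nat (k - 1) = (of_nat k - 1 :: complex)" for a :: complex
      using k by (simp_all add: of_nat_diff Suc_diff_Suc numeral_2_eq_2 flip: power_Suc)
    have "of_nat k * p - 1 \<noteq> 0 \<Longrightarrow> m1 \<noteq> k" using m0 by (auto simp: p_def)
    then have B: "(\<lambda>z. (of_nat k * p - 1) * M 1 k z) analytic_on {\<tau>}"
      using k \<tau> by (intro M_analytic_unless_zero an1) auto
    \<comment> \<open>The neighbouring monomial \<open>x^2 * y^(k - 1)\<close> is split as
      \<open>(x * y) * (x * y^(k - 2))\<close>, which is the source of the product of
      \<open>E4\<close> with the series of weight \<open>2 * k - 2\<close>.\<close>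
    have A: "(\<lambda>z. (of_nat k * r - (of_nat k - 1)) * (M 1 1 z * M 1 (k - 2) z)) analytic_on {\<tau>}"
      using k \<tau> by (intro analytic_intros an1) auto
    have "has_D (M 1 (k - 1)) (of_nat (1 + (k - 1)) * (K * E2 \<tau>) * M 1 (k - 1) \<tau>
      + (of_nat k * r - (of_nat k - 1)) * (M 1 1 \<tau> * M 1 (k - 2) \<tau>) + (of_nat k * p - 1) * M 1 k \<tau>) \<tau>"
    proof (rule M_identity[OF \<tau> _ _ A _ B])
      show "1 \<le> (k - 1) * (m2 - 1)" "k - 1 \<le> 1 * (m1 - 1)"
        using k m by auto
      fix z assume z: "regular z"
      show "(of_nat k * r - (of_nat k - 1)) * (M 1 1 z * M 1 (k - 2) z) =
          (of_nat (1 + (k - 1)) * r - of_nat (k - 1)) * (x z ^ Suc 1 * y z ^ (k - 1))"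
        unfolding of M_regular[OF z] pow by (simp add: mult_ac)
      show "(of_nat k * p - 1) * M 1 k z =
          (of_nat (1 + (k - 1)) * p - of_nat 1) * (x z ^ 1 * y z ^ Suc (k - 1))"
        unfolding of M_regular[OF z] Suc by simp
    qed
    then show ?thesis
      by (rule has_D_eq) (unfold of, simp add: algebra_simps)
  qed
  have 4: "has_D (M (k - 1) 1) (of_nat k * K * E2 \<tau> * M (k - 1) 1 \<tau>
      - (of_nat k - 1 - of_nat k * p) * M 1 1 \<tau> * M (k - 2) 1 \<tau> - (1 - of_nat k * r) * M k 1 \<tau>) \<tau>"
    if k: "2 < k" "k \<le> m2" and \<tau>: "\<tau> \<in> uhp" for k \<tau>
  proof -
    have Suc: "Suc (k - 1) = k" and pow: "a ^ (k - 1) = a * a ^ (k - 2)" and of: "of_nat (k - 1 + 1) = (of_nat k :: complex)"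
      "of_nat (k - 1) = (of_nat k - 1 :: complex)" for a :: complex
      using k by (simp_all add: of_nat_diff Suc_diff_Suc numeral_2_eq_2 flip: power_Suc)
    have "of_nat k * r - 1 \<noteq> 0 \<Longrightarrow> m2 \<noteq> k" using m0 by (auto simp: r_def)
    then have A: "(\<lambda>z. (of_nat k * r - 1) * M k 1 z) analytic_on {\<tau>}"
      using k \<tau> by (intro M_analytic_unless_zero an2) auto
    \<comment> \<open>With \<open>x\<close> and \<open>y\<close> exchanged, the monomial to be split
      is \<open>x^(k - 1) * y^2\<close>, so the product with \<open>E4\<close> now sits in the term
      with \<open>p\<close>.\<close>
    have B: "(\<lambda>z. (of_nat k * p - (of_nat k - 1)) * (M 1 1 z * M (k - 2) 1 z)) analytic_on {\<tau>}"
      using k \<tau> by (intro analytic_intros an2) auto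
    have "has_D (M (k - 1) 1) (of_nat (k - 1 + 1) * (K * E2 \<tau>) * M (k - 1) 1 \<tau>
      + (of_nat k * r - 1) * M k 1 \<tau> + (of_nat k * p - (of_nat k - 1)) * (M 1 1 \<tau> * M (k - 2) 1 \<tau>)) \<tau>"
    proof (rule M_identity[OF \<tau> _ _ A _ B])
      show "k - 1 \<le> 1 * (m2 - 1)" "1 \<le> (k - 1) * (m1 - 1)"
        using k m by auto
      fix z assume z: "regular z"
      show "(of_nat k * p - (of_nat k - 1)) * (M 1 1 z * M (k - 2) 1 z) =
          (of_nat (k - 1 + 1) * p - of_nat (k - 1)) * (x z ^ (k - 1) * y z ^ Suc 1)"
        unfolding of M_regular[OF z] pow by (simp add: mult_ac)
      show "(of_nat k * r - 1) * M k 1 z =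
          (of_nat (k - 1 + 1) * r - of_nat 1) * (x z ^ Suc (k - 1) * y z ^ 1)"
        unfolding of M_regular[OF z] Suc by simp
    qed
    then show ?thesis
      by (rule has_D_eq) (unfold of, simp add: algebra_simps)
  qed
  have K2: "(of_nat m1 * of_nat m2 - of_nat m1 - of_nat m2) / (2 * of_nat m1 * of_nat m2) = K / 2"
    unfolding K[symmetric] by simp
  have Kk: "of_nat k * (of_nat m1 * of_nat m2 - of_nat m1 - of_nat m2) / (of_nat m1 * of_nat m2)
      = of_nat k * K" for k
    unfolding K[symmetric] by simp
  have ks: "3 - 1 = (2 :: nat)" "k + 1 - 1 = k" "k - 1 - 1 = k - 2" for k :: nat by auto
  show ?thesis
    unfolding rew K2 Kk K pk2 rk2 pk rk pk' rk' ks
    using 1 2 3 4 by blast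
qed

end
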